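(* Let $\mathcal{A}$ be a complex unital Banach algebra and let $x_1,x_2,x_3\in\mathcal{A}$ satisfy $$x_1+x_2+x_3=\alpha_1+\alpha_2(x_1x_2+x_1x_3+x_2x_3)\quad\text{and}\quad x_1x_2x_3=\beta(x_1x_2+x_1x_3+x_2x_3)$$ for some $\alpha_1,\alpha_2,\beta\in\mathbb{C}$. Let $X=\{x_1,x_2,x_3,x_1x_2+x_1x_3+x_2x_3\}$. If any three of the four elements of $X$ are Drazin invertible (respectively, g-Drazin invertible), then the remaining one is also Drazin invertible (respectively, g-Drazin invertible).
   Context: $\mathcal{A}$ is a complex unital Banach algebra with unit $1$. An element $a\in\mathcal{A}$ is Drazin invertible if there exists $b\in\mathcal{A}$ with $ab=ba$, $bab=b$, and $(a(1-ab))^n=0$ for some $n\in\mathbb{N}$. It is generalized Drazin (g-Drazin) invertible if there exists $b\in\mathcal{A}$ with $ab=ba$, $bab=b$, and $a(1-ab)$ quasinilpotent (spectral radius $0$). *)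

theory Defs
  imports "HOL-Analysis.Analysis"
begin

text \<open>Complex unital Banach algebras: a real unital Banach algebra with a compatible
  complex scalar multiplication (HOL has no class of complex vector spaces).\<close>
class complex_banach_algebra_1 = real_normed_algebra_1 + banach +
  fixes scaleC :: "complex \<Rightarrow> 'a \<Rightarrow> 'a" (infixr \<open>*\<^sub>C\<close> 75)
  assumes scaleC_add_right: "c *\<^sub>C (x + y) = c *\<^sub>C x + c *\<^sub>C y"
    and scaleC_add_left: "(c + d) *\<^sub>C x = c *\<^sub>C x + d *\<^sub>C x"
    and scaleC_scaleC: "c *\<^sub>C (d *\<^sub>C x) = (c * d) *\<^sub>C x"
    and scaleC_one: "1 *\<^sub>C x = x"
    and scaleR_scaleC: "r *\<^sub>R x = complex_of_real r *\<^sub>C x"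
    and norm_scaleC: "norm (c *\<^sub>C x) = cmod c * norm x"
    and mult_scaleC_left: "(c *\<^sub>C x) * y = c *\<^sub>C (x * y)"
    and mult_scaleC_right: "x * (c *\<^sub>C y) = c *\<^sub>C (x * y)"

definition cscal :: "complex \<Rightarrow> 'a::complex_banach_algebra_1" where
  "cscal c = c *\<^sub>C 1"

definition alg_invertible :: "'a::ring_1 \<Rightarrow> bool" where
  "alg_invertible a \<longleftrightarrow> (\<exists>b. a * b = 1 \<and> b * a = 1)"

definition alg_spectrum :: "'a::complex_banach_algebra_1 \<Rightarrow> complex set" where
  "alg_spectrum a = {z. \<not> alg_invertible (cscal z - a)}"

definition quasinilpotent :: "'a::complex_banach_algebra_1 \<Rightarrow> bool" where
  "quasinilpotent a \<longleftrightarrow> alg_spectrum a \<subseteq> {0}"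

definition drazin_invertible :: "'a::complex_banach_algebra_1 \<Rightarrow> bool" where
  "drazin_invertible a \<longleftrightarrow>
     (\<exists>b. a * b = b * a \<and> b * a * b = b \<and> (\<exists>n::nat. (a * (1 - a * b)) ^ n = 0))"

definition gdrazin_invertible :: "'a::complex_banach_algebra_1 \<Rightarrow> bool" where
  "gdrazin_invertible a \<longleftrightarrow>
     (\<exists>b. a * b = b * a \<and> b * a * b = b \<and> quasinilpotent (a * (1 - a * b)))"

end

theory Submission
  imports Defs "HOL-Complex_Analysis.Conformal_Mappings"
begin

text \<open>
An element \<open>a\<close> is g-Drazin invertible iff \<open>z - a\<close> is invertible for all small \<open>z \<noteq> 0\<close>, and Drazin
invertible iff in addition \<open>\<parallel>(z - a)\<^sup>-\<^sup>1\<parallel>\<close> grows at most like a power of \<open>1 / |z|\<close>. With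
\<open>u = x1 x2 + x1 x3 + x2 x3\<close> and \<open>q(z) = z - \<alpha>2 z\<^sup>2 - \<beta>\<close> the hypotheses say precisely that
\<open>(z - x1)(z - x2)(z - x3) = z\<^sup>3 - \<alpha>1 z\<^sup>2 + q(z) u = - q(z) (L(z) - u)\<close>, where
\<open>L(z) = z\<^sup>2 (\<alpha>1 - z) / q(z)\<close> is a nonconstant holomorphic function with \<open>L(0) = 0\<close>. Hence invertibility
(with power growth of the inverse) of three of the factors for small \<open>z \<noteq> 0\<close> gives that of the fourth;
if the fourth is \<open>u\<close>, the open mapping theorem shows that \<open>L(z)\<close> covers a neighbourhood of \<open>0\<close>.

The Riesz idempotent of \<open>a\<close> at \<open>0\<close> is obtained without vector-valued contour integrals: the average of
\<open>z (z - a)\<^sup>-\<^sup>1\<close> over the \<open>n\<close> points with \<open>z\<^sup>n = r\<^sup>n\<close> is exactly \<open>f\<^sub>n = (1 - (a/r)\<^sup>n)\<^sup>-\<^sup>1\<close>. As Riemann sums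
the \<open>f\<^sub>n\<close> converge, and \<open>f\<^sub>2\<^sub>n = f\<^sub>n (2 f\<^sub>2\<^sub>n - f\<^sub>n)\<close> makes the limit idempotent.
\<close>

subsection \<open>Scalars and inverses in a complex Banach algebra\<close>

lemma cscal_add: "cscal (z + w) = cscal z + cscal w"
  by (simp add: cscal_def scaleC_add_left)

lemma cscal_0 [simp]: "cscal 0 = 0"
  using cscal_add[of 0 0] by simp

lemma cscal_1 [simp]: "cscal 1 = 1"
  by (simp add: cscal_def scaleC_one)

lemma cscal_minus: "cscal (- z) = - cscal z"
  using cscal_add[of z "- z"] by (simp add: eq_neg_iff_add_eq_0 add.commute)

lemma cscal_diff: "cscal (z - w) = cscal z - cscal w"
  using cscal_add[of z "- w"] by (simp add: cscal_minus)

lemma cscal_mult: "cscal (z * w) = cscal z * cscal w"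
  by (simp add: cscal_def mult_scaleC_left scaleC_scaleC)

lemma cscal_sum: "cscal (sum f A) = (\<Sum>i\<in>A. cscal (f i))"
  by (induction A rule: infinite_finite_induct) (simp_all add: cscal_add)

lemma cscal_commute: "x * cscal z = cscal z * x"
  by (simp add: cscal_def mult_scaleC_left mult_scaleC_right)

lemma cscal_left_commute: "x * (cscal z * y) = cscal z * (x * y)"
  by (metis cscal_commute mult.assoc)

lemma cscal_of_real: "cscal (complex_of_real r) = of_real r"
  by (simp add: cscal_def of_real_def scaleR_scaleC)

lemma norm_cscal [simp]: "norm (cscal z :: 'a::complex_banach_algebra_1) = cmod z"
  by (simp add: cscal_def norm_scaleC)

lemma norm_cscal_mult: "norm (cscal z * x) = cmod z * norm x"
  by (simp add: cscal_def mult_scaleC_left norm_scaleC)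

lemma cscal_inverse_mult [simp]:
  assumes "z \<noteq> 0"
  shows "cscal z * cscal (inverse z) = 1" "cscal (inverse z) * cscal z = 1"
  using assms by (simp_all flip: cscal_mult)

lemma bounded_linear_cscal: "bounded_linear (cscal :: complex \<Rightarrow> 'a::complex_banach_algebra_1)"
proof (rule bounded_linear_intro[where K=1])
  fix r and z :: complex
  show "cscal (r *\<^sub>R z) = r *\<^sub>R (cscal z :: 'a)"
    by (simp add: scaleR_conv_of_real cscal_mult cscal_of_real)
qed (simp_all add: cscal_add)

lemmas tendsto_cscal [tendsto_intros] = bounded_linear.tendsto[OF bounded_linear_cscal]
lemmas continuous_on_cscal [continuous_intros] = bounded_linear.continuous_on[OF bounded_linear_cscal]

section \<open>Two-sided inverses, the Neumann series and the resolvent\<close>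

definition is_inv :: "'a::ring_1 \<Rightarrow> 'a \<Rightarrow> bool" where
  "is_inv a b \<longleftrightarrow> a * b = 1 \<and> b * a = 1"

lemma alg_invertible_iff: "alg_invertible a \<longleftrightarrow> (\<exists>b. is_inv a b)"
  by (simp add: alg_invertible_def is_inv_def)

lemma is_inv_left_right:
  assumes "b * a = 1" "a * c = 1"
  shows "is_inv a b" "is_inv a c"
proof -
  have "b = c" by (metis assms mult.assoc mult.left_neutral mult.right_neutral)
  then show "is_inv a b" "is_inv a c" using assms by (auto simp: is_inv_def)
qed

lemma is_inv_unique: "is_inv a b \<Longrightarrow> is_inv a c \<Longrightarrow> b = c"
  unfolding is_inv_def by (metis mult.assoc mult.left_neutral mult.right_neutral)

lemma is_inv_mult: "is_inv a b \<Longrightarrow> is_inv c d \<Longrightarrow> is_inv (a * c) (d * b)"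
  unfolding is_inv_def by (metis mult.assoc mult.right_neutral)

lemma is_inv_commute:
  assumes "is_inv a b" "a * x = x * a"
  shows "b * x = x * b"
proof -
  have "b * x = b * (x * a) * b" using assms by (simp add: is_inv_def mult.assoc)
  also have "\<dots> = b * (a * x) * b" by (simp only: assms(2))
  also have "\<dots> = (b * a) * (x * b)" by (simp only: mult.assoc)
  finally show ?thesis using assms(1) by (simp add: is_inv_def)
qed

lemma is_inv_cscal: "z \<noteq> 0 \<Longrightarrow> is_inv (cscal z) (cscal (inverse z))"
  by (simp add: is_inv_def)

text \<open>The inverse is the geometric series. Reading it as \<open>v = 1 + x * v\<close> gives
  the norm bound, which later keeps inverses bounded near the origin.\<close>

lemma neumann_inverse:
  fixes x :: "'a::{real_normed_algebra_1,banach}"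
  assumes "norm x < 1"
  obtains v where "is_inv (1 - x) v" "norm v \<le> 1 / (1 - norm x)"
proof
  define v where "v = (\<Sum>n. x ^ n)"
  have sm: "summable (\<lambda>n. x ^ n)"
    using complete_algebra_summable_geometric[OF assms] .
  have "v = 1 + (\<Sum>n. x ^ Suc n)"
    unfolding v_def using suminf_split_head[OF sm] by simp
  moreover have "(\<Sum>n. x ^ Suc n) = x * v" "(\<Sum>n. x ^ Suc n) = v * x"
    using suminf_mult[OF sm] suminf_mult2[OF sm] unfolding v_def by (simp, simp only: power_Suc2)
  ultimately show inv: "is_inv (1 - x) v"
    by (simp add: is_inv_def algebra_simps)
  have "v = 1 + x * v"
    using inv by (simp add: is_inv_def algebra_simps)
  then have "norm v \<le> 1 + norm x * norm v"
    by (metis norm_triangle_le norm_one norm_mult_ineq add_left_mono)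
  then show "norm v \<le> 1 / (1 - norm x)"
    using assms by (simp add: field_simps)
qed

text \<open>The value is unspecified where \<open>z - a\<close> has no inverse, so statements about
  it carry an invertibility hypothesis. By uniqueness it agrees with any inverse found by other
  means.\<close>

definition resolv :: "'a::complex_banach_algebra_1 \<Rightarrow> complex \<Rightarrow> 'a" where
  "resolv a z = (THE b. is_inv (cscal z - a) b)"

lemma resolv_eqI: "is_inv (cscal z - a) b \<Longrightarrow> resolv a z = b"
  unfolding resolv_def using is_inv_unique by blast

lemma is_inv_resolv: "alg_invertible (cscal z - a) \<Longrightarrow> is_inv (cscal z - a) (resolv a z)"
  using resolv_eqI alg_invertible_iff by metis

lemma resolv_commute:
  assumes "alg_invertible (cscal z - a)"  "a * x = x * a"
  shows "resolv a z * x = x * resolv a z"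
  using is_inv_commute[OF is_inv_resolv[OF assms(1)], of x] assms(2)
  by (simp add: algebra_simps cscal_commute)

lemma mult_resolv:
  assumes "alg_invertible (cscal z - a)"
  shows "a * resolv a z = cscal z * resolv a z - 1"
  using is_inv_resolv[OF assms] by (simp add: is_inv_def algebra_simps)

lemma resolv_identity:
  assumes "alg_invertible (cscal z - a)" "alg_invertible (cscal w - a)"
  shows "resolv a z - resolv a w = cscal (w - z) * (resolv a z * resolv a w)"
proof -
  have "resolv a z - resolv a w =
      resolv a z * ((cscal w - a) * resolv a w) - (resolv a z * (cscal z - a)) * resolv a w"
    using assms[THEN is_inv_resolv] by (simp add: is_inv_def)
  also have "\<dots> = resolv a z * (cscal (w - z) * resolv a w)"
    by (simp add: algebra_simps cscal_diff)
  finally show ?thesis by (simp add: cscal_left_commute)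
qed

text \<open>The resolvent identity bounds the increment by \<open>cmod (z0 - z)\<close> times the
  norms of both resolvents. The norm at \<open>z\<close> is not known beforehand, so the identity
  serves twice: first to bound it, then to estimate the increment.\<close>

lemma continuous_on_resolv:
  assumes inv: "\<And>z. z \<in> S \<Longrightarrow> alg_invertible (cscal z - a)"
  shows "continuous_on S (resolv a)"
  unfolding continuous_on_iff
proof (intro ballI allI impI)
  fix z0 and e :: real assume z0: "z0 \<in> S" and e: "e > 0"
  define M where "M = norm (resolv a z0) + 1"
  have M: "M > 0" "norm (resolv a z0) \<le> M" by (simp_all add: M_def add_nonneg_pos)
  \<comment> \<open>The first entry lets half of \<open>norm (resolv a z)\<close> be absorbed,
    whence \<open>norm (resolv a z) \<le> 2 * M\<close>; with that, the second entry bounds the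
    increment by \<open>e / 2\<close>.\<close>
  define d where "d = min (1 / (2 * M)) (e / (4 * M\<^sup>2))"
  have "d > 0" using M e by (simp add: d_def)
  moreover have "dist (resolv a z) (resolv a z0) < e" if z: "z \<in> S" "dist z z0 < d" for z
  proof -
    have zd: "cmod (z0 - z) < 1 / (2 * M)" "cmod (z0 - z) < e / (4 * M\<^sup>2)"
      using z by (simp_all add: d_def dist_norm norm_minus_commute)
    have eq: "norm (resolv a z - resolv a z0) \<le> cmod (z0 - z) * (norm (resolv a z) * M)"
      unfolding resolv_identity[OF inv[OF z(1)] inv[OF z0]] norm_cscal_mult
      by (intro mult_left_mono order.trans[OF norm_mult_ineq] M) auto
    have "cmod (z0 - z) * M * norm (resolv a z) \<le> (1 / 2) * norm (resolv a z)"
      using zd(1) M by (intro mult_right_mono) (auto simp: field_simps)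
    with eq have "norm (resolv a z - resolv a z0) \<le> norm (resolv a z) / 2"
      by (simp add: mult_ac)
    then have nz: "norm (resolv a z) \<le> 2 * M"
      using norm_triangle_sub[of "resolv a z" "resolv a z0"] M by simp
    have "cmod (z0 - z) * (norm (resolv a z) * M) \<le> cmod (z0 - z) * (2 * M * M)"
      using nz M by (intro mult_left_mono mult_right_mono) auto
    also have "\<dots> \<le> e / (4 * M\<^sup>2) * (2 * M * M)"
      using zd(2) M by (intro mult_right_mono) auto
    also have "\<dots> < e" using M e by (simp add: power2_eq_square)
    finally show ?thesis using eq by (simp add: dist_norm)
  qed
  ultimately show "\<exists>d>0. \<forall>x'\<in>S. dist x' z0 < d \<longrightarrow> dist (resolv a x') (resolv a z0) < e"
    by blast
qed

text \<open>Truncated geometric series in \<open>a / z\<close>, with no convergence involved. It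
  inverts \<open>z - a\<close> as soon as \<open>1 - (a / z)^n\<close> is invertible: for nilpotent
  \<open>a\<close>, for \<open>a\<close> with a small power, and in averages over points with equal
  \<open>n\<close>-th powers.\<close>

lemma resolvent_telescope:
  fixes a :: "'a::complex_banach_algebra_1"
  assumes "z \<noteq> 0"
  shows "(cscal z - a) * (\<Sum>j<n. cscal (inverse z ^ j) * a ^ j) = cscal z * (1 - cscal (inverse z ^ n) * a ^ n)" (is "?l n = ?r n")
    and "(\<Sum>j<n. cscal (inverse z ^ j) * a ^ j) * (cscal z - a) = cscal z * (1 - cscal (inverse z ^ n) * a ^ n)" (is "?l' n = ?r n")
proof -
  have step: "cscal (inverse z ^ n) * a ^ n * cscal z = cscal z * (cscal (inverse z ^ n) * a ^ n)"
    "cscal (inverse z ^ n) * a ^ n * a = cscal z * (cscal (inverse z ^ Suc n) * a ^ Suc n)"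
    "a * (cscal (inverse z ^ n) * a ^ n) = cscal z * (cscal (inverse z ^ Suc n) * a ^ Suc n)" for n
  proof -
    have "inverse z ^ n = z * inverse z ^ Suc n" using assms by simp
    then have "cscal (inverse z ^ n) = (cscal z * cscal (inverse z ^ Suc n) :: 'a)"
      by (metis cscal_mult)
    then show "cscal (inverse z ^ n) * a ^ n * a = cscal z * (cscal (inverse z ^ Suc n) * a ^ Suc n)"
      by (metis mult.assoc power_Suc2)
    moreover have "a * (cscal (inverse z ^ n) * a ^ n) = cscal (inverse z ^ n) * a ^ n * a"
      by (simp only: cscal_left_commute[of a] power_commutes mult.assoc)
    ultimately show "a * (cscal (inverse z ^ n) * a ^ n) = cscal z * (cscal (inverse z ^ Suc n) * a ^ Suc n)"
      by simp
  qed (rule cscal_commute)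
  show "?l n = ?r n"
  proof (induction n)
    case (Suc n)
    then show ?case
      using step(3)[of n] by (simp add: algebra_simps del: power_Suc)
  qed simp
  show "?l' n = ?r n"
  proof (induction n)
    case (Suc n)
    then show ?case
      using step(1,2)[of n] by (simp add: algebra_simps del: power_Suc)
  qed simp
qed

subsection \<open>Inverses of power growth at the origin\<close>

text \<open>Families are germs at \<open>0\<close>. With \<open>pole = False\<close> no growth is controlled (g-Drazin case); with
  \<open>pole = True\<close> the inverses have at most a pole (Drazin case). Constants are absorbed in the exponent,
  since \<open>C \<le> 1 / |z|\<close> near \<open>0\<close>.\<close>
definition tame :: "(complex \<Rightarrow> 'a::real_normed_vector) \<Rightarrow> bool" where
  "tame X \<longleftrightarrow> (\<exists>N. \<forall>\<^sub>F z in at 0. norm (X z) \<le> inverse (cmod z) ^ N)"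

definition inv_tame :: "bool \<Rightarrow> (complex \<Rightarrow> 'a::real_normed_algebra_1) \<Rightarrow> bool" where
  "inv_tame pole X \<longleftrightarrow> (\<exists>Y. (\<forall>\<^sub>F z in at 0. is_inv (X z) (Y z)) \<and> (pole \<longrightarrow> tame Y))"

lemma eventually_norm_less_at_0: "r > 0 \<Longrightarrow> \<forall>\<^sub>F z::complex in at 0. cmod z < r"
  using eventually_at[of "\<lambda>z. cmod z < r" "0::complex" UNIV] by auto

lemma eventually_neq_0: "\<forall>\<^sub>F z::complex in at 0. z \<noteq> 0"
  by (simp add: eventually_neq_at_within)

lemma tame_mono:
  assumes "tame Y" "\<forall>\<^sub>F z in at 0. norm (X z) \<le> norm (Y z)"
  shows "tame X"
  using assms unfolding tame_def by (smt (verit) eventually_elim2)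

text \<open>A convergent germ is bounded near the origin by \<open>norm l + 1\<close>, and one
  factor \<open>1 / |z|\<close> exceeds this constant.\<close>

lemma tame_tendsto:
  assumes "(X \<longlongrightarrow> l) (at 0)"
  shows "tame X"
proof -
  have "\<forall>\<^sub>F z in at 0. norm (X z) < norm l + 1"
    using tendsto_norm[OF assms] by (rule order_tendstoD) simp
  moreover have "\<forall>\<^sub>F z::complex in at 0. cmod z < inverse (norm l + 1)"
    by (rule eventually_norm_less_at_0) (simp add: add_nonneg_pos)
  ultimately have "\<forall>\<^sub>F z in at 0. norm (X z) \<le> inverse (cmod z) ^ 1"
    using eventually_neq_0
  proof eventually_elim
    case (elim z)
    then have "norm l + 1 \<le> inverse (cmod z)"
      using less_imp_inverse_less[of "cmod z" "inverse (norm l + 1)"] by simp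
    with elim show ?case by simp
  qed
  then show ?thesis unfolding tame_def by blast
qed

lemma tame_const: "tame (\<lambda>z. c)"
  by (rule tame_tendsto[OF tendsto_const])

lemma tame_mult:
  fixes X Y :: "complex \<Rightarrow> 'a::real_normed_algebra"
  assumes "tame X" "tame Y"
  shows "tame (\<lambda>z. X z * Y z)"
proof -
  obtain N M where "\<forall>\<^sub>F z in at 0. norm (X z) \<le> inverse (cmod z) ^ N"
    "\<forall>\<^sub>F z in at 0. norm (Y z) \<le> inverse (cmod z) ^ M"
    using assms unfolding tame_def by blast
  then have "\<forall>\<^sub>F z in at 0. norm (X z * Y z) \<le> inverse (cmod z) ^ (N + M)"
  proof eventually_elim
    case (elim z)
    then show ?case
      unfolding power_add by (intro order.trans[OF norm_mult_ineq] mult_mono) auto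
  qed
  then show ?thesis unfolding tame_def by blast
qed

lemma tame_add:
  assumes "tame X" "tame Y"
  shows "tame (\<lambda>z. X z + Y z)"
proof -
  obtain N M where "\<forall>\<^sub>F z in at 0. norm (X z) \<le> inverse (cmod z) ^ N"
    "\<forall>\<^sub>F z in at 0. norm (Y z) \<le> inverse (cmod z) ^ M"
    using assms unfolding tame_def by blast
  \<comment> \<open>Below this radius \<open>1 / |z|\<close> is at least 2, so one extra power pays
    for adding two terms.\<close>
  moreover have "\<forall>\<^sub>F z::complex in at 0. cmod z < 1 / 2"
    by (rule eventually_norm_less_at_0) simp
  ultimately have "\<forall>\<^sub>F z in at 0. norm (X z + Y z) \<le> inverse (cmod z) ^ (Suc (N + M))"
    using eventually_neq_0
  proof eventually_elim
    case (elim z)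
    define t where "t = inverse (cmod z)"
    have t: "t \<ge> 2" using elim by (simp add: t_def field_simps)
    have "norm (X z + Y z) \<le> t ^ N + t ^ M"
      using elim norm_triangle_ineq[of "X z" "Y z"] by (simp add: t_def)
    also have "\<dots> \<le> t ^ (N + M) + t ^ (N + M)"
      using t by (intro add_mono power_increasing) auto
    also have "\<dots> \<le> t ^ Suc (N + M)"
      using t mult_right_mono[OF t, of "t ^ (N + M)"] by simp
    finally show ?case by (simp add: t_def)
  qed
  then show ?thesis unfolding tame_def by blast
qed

lemma tame_sum: "finite A \<Longrightarrow> (\<And>i. i \<in> A \<Longrightarrow> tame (X i)) \<Longrightarrow> tame (\<lambda>z. \<Sum>i\<in>A. X i z)"
  by (induction A rule: finite_induct) (simp_all add: tame_const tame_add)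

lemma tame_cscal_inverse_power: "tame (\<lambda>z. cscal (inverse z ^ n) :: 'a::complex_banach_algebra_1)"
  unfolding tame_def by (rule exI[of _ n]) (simp add: norm_power norm_inverse)

lemma inv_tameI:
  "\<forall>\<^sub>F z in at 0. is_inv (X z) (Y z) \<Longrightarrow> (pole \<Longrightarrow> tame Y) \<Longrightarrow> inv_tame pole X"
  unfolding inv_tame_def by blast

lemma inv_tameE:
  assumes "inv_tame pole X"
  obtains Y where "\<forall>\<^sub>F z in at 0. is_inv (X z) (Y z)" "pole \<Longrightarrow> tame Y"
  using assms unfolding inv_tame_def by blast

lemma inv_tame_cong:
  assumes "inv_tame pole X" "\<forall>\<^sub>F z in at 0. X z = X' z"
  shows "inv_tame pole X'"
proof -
  obtain Y where Y: "\<forall>\<^sub>F z in at 0. is_inv (X z) (Y z)" "pole \<Longrightarrow> tame Y"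
    using assms(1) inv_tameE by blast
  have "\<forall>\<^sub>F z in at 0. is_inv (X' z) (Y z)"
    using Y(1) assms(2) by eventually_elim simp
  then show ?thesis using Y(2) by (rule inv_tameI)
qed

lemma inv_tame_mult:
  assumes "inv_tame pole X" "inv_tame pole Y"
  shows "inv_tame pole (\<lambda>z. X z * Y z)"
proof -
  obtain X' Y' where X': "\<forall>\<^sub>F z in at 0. is_inv (X z) (X' z)" "pole \<Longrightarrow> tame X'"
    and Y': "\<forall>\<^sub>F z in at 0. is_inv (Y z) (Y' z)" "pole \<Longrightarrow> tame Y'"
    using assms inv_tameE by metis
  show ?thesis
  proof (rule inv_tameI)
    show "\<forall>\<^sub>F z in at 0. is_inv (X z * Y z) (Y' z * X' z)"
      using X'(1) Y'(1) by eventually_elim (rule is_inv_mult)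
  qed (use X' Y' tame_mult in blast)
qed

text \<open>If \<open>W\<close> inverts \<open>X Y\<close>, then \<open>Y W\<close> is a right
  inverse of \<open>X\<close>, and conjugating with the invertible \<open>Y\<close> shows that it is
  a left inverse too. Tameness of \<open>Y\<close> enters because \<open>Y\<close> is a factor of
  the new inverse.\<close>

lemma inv_tame_cancel_right:
  assumes "inv_tame pole (\<lambda>z. X z * Y z)" "inv_tame pole Y" "tame Y"
  shows "inv_tame pole X"
proof -
  obtain W Y' where W: "\<forall>\<^sub>F z in at 0. is_inv (X z * Y z) (W z)" "pole \<Longrightarrow> tame W"
    and Y': "\<forall>\<^sub>F z in at 0. is_inv (Y z) (Y' z)" "pole \<Longrightarrow> tame Y'"
    using assms inv_tameE by metis
  show ?thesis
  proof (rule inv_tameI)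
    show "\<forall>\<^sub>F z in at 0. is_inv (X z) (Y z * W z)"
      using W(1) Y'(1)
    proof eventually_elim
      case (elim z)
      have *: "X z * (Y z * W z) = 1" using elim by (simp add: is_inv_def mult.assoc)
      have "Y z * Y' z = 1" using elim by (simp add: is_inv_def)
      then have "(Y z * W z) * X z = Y z * (W z * (X z * Y z)) * Y' z"
        by (simp add: mult.assoc)
      also have "\<dots> = 1" using elim by (simp add: is_inv_def)
      finally show ?case using * by (simp add: is_inv_def)
    qed
  qed (use W assms tame_mult in blast)
qed

lemma inv_tame_cancel_left:
  assumes "inv_tame pole (\<lambda>z. X z * Y z)" "inv_tame pole X" "tame X"
  shows "inv_tame pole Y"
proof -
  obtain W X' where W: "\<forall>\<^sub>F z in at 0. is_inv (X z * Y z) (W z)" "pole \<Longrightarrow> tame W"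
    and X': "\<forall>\<^sub>F z in at 0. is_inv (X z) (X' z)" "pole \<Longrightarrow> tame X'"
    using assms inv_tameE by metis
  show ?thesis
  proof (rule inv_tameI)
    show "\<forall>\<^sub>F z in at 0. is_inv (Y z) (W z * X z)"
      using W(1) X'(1)
    proof eventually_elim
      case (elim z)
      have *: "(W z * X z) * Y z = 1" using elim by (simp add: is_inv_def mult.assoc)
      have "X' z * X z = 1" using elim by (simp add: is_inv_def)
      then have "Y z * (W z * X z) = X' z * ((X z * Y z) * W z) * X z"
        by (simp flip: mult.assoc)
      also have "\<dots> = 1" using elim by (simp add: is_inv_def)
      finally show ?case using * by (simp add: is_inv_def)
    qed
  qed (use W assms tame_mult in blast)
qed

lemma tame_cscal_diff: "isCont f 0 \<Longrightarrow> tame (\<lambda>z. cscal (f z) - a)"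
  by (rule tame_tendsto) (auto intro!: tendsto_intros simp: isCont_def)

section \<open>From Drazin inverses to resolvents near the origin\<close>

lemma inv_tame_nilpotent:
  assumes "c ^ n = 0"
  shows "inv_tame pole (\<lambda>z. cscal z - c)"
proof (rule inv_tameI)
  \<comment> \<open>As \<open>c ^ n = 0\<close>, the truncated series is exact and the inverse is a
    polynomial in \<open>1 / z\<close>. The exponent 1 below matches the form of
    \<open>tame_cscal_inverse_power\<close>.\<close>
  let ?S = "\<lambda>z. \<Sum>j<n. cscal (inverse z ^ j) * c ^ j"
  show "\<forall>\<^sub>F z in at 0. is_inv (cscal z - c) (cscal (inverse z ^ 1) * ?S z)"
    using eventually_neq_0
  proof eventually_elim
    case (elim z)
    have "(cscal z - c) * ?S z = cscal z" "?S z * (cscal z - c) = cscal z"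
      using resolvent_telescope[OF elim, of c n] assms by simp_all
    with elim show ?case
      by (simp add: is_inv_def cscal_left_commute mult.assoc)
  qed
  show "tame (\<lambda>z. cscal (inverse z ^ 1) * ?S z)"
    by (intro tame_mult tame_cscal_inverse_power tame_sum tame_const) simp
qed

lemma inv_tame_quasinilpotent:
  assumes "quasinilpotent c"
  shows "inv_tame False (\<lambda>z. cscal z - c)"
proof (rule inv_tameI)
  show "\<forall>\<^sub>F z in at 0. is_inv (cscal z - c) (resolv c z)"
    using eventually_neq_0
  proof eventually_elim
    case (elim z)
    then show ?case using assms
      by (intro is_inv_resolv) (auto simp: quasinilpotent_def alg_spectrum_def)
  qed
qed simp

text \<open>The idempotent \<open>p = 1 - a * b\<close> splits the algebra. On the part of
  \<open>p\<close>, \<open>z - a\<close> acts as \<open>z - a * p\<close>, whose inverse is given;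
  on the part of \<open>a * b\<close>, where \<open>b\<close> inverts \<open>a\<close>, it acts as
  \<open>- a (1 - z b)\<close>, whose inverse \<open>- b (1 - z b)^(-1)\<close> stays
  bounded.\<close>

lemma inv_tame_of_spectral_splitting:
  assumes ab: "a * b = b * a" and bab: "b * a * b = b"
    and c: "inv_tame pole (\<lambda>z. cscal z - a * (1 - a * b))"
  shows "inv_tame pole (\<lambda>z. cscal z - a)"
proof -
  define p where "p = 1 - a * b"
  have abb: "a * b * b = b" "b * (a * b) = b" by (metis ab bab) (metis bab mult.assoc)
  have "(a * b) * (a * b) = a * b" by (metis bab mult.assoc)
  then have pp: "p * p = p" by (simp add: p_def left_diff_distrib right_diff_distrib)
  have "a * (a * b) = (a * b) * a" by (metis ab mult.assoc)
  then have ap: "a * p = p * a" by (simp add: p_def left_diff_distrib right_diff_distrib)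
  obtain R where R: "\<forall>\<^sub>F z in at 0. is_inv (cscal z - a * p) (R z)" "pole \<Longrightarrow> tame R"
    using c inv_tameE unfolding p_def by metis
  let ?v = "\<lambda>z. THE v. is_inv (1 - cscal z * b) v"
  \<comment> \<open>The radius makes \<open>norm (cscal z * b) < 1 / 2\<close>, so the Neumann bound
    is 2; the summand 1 keeps the denominator positive when \<open>b = 0\<close>.\<close>
  have ev: "\<forall>\<^sub>F z in at 0. is_inv (1 - cscal z * b) (?v z) \<and> norm (?v z) \<le> 2"
    using eventually_norm_less_at_0[of "1 / (2 * (norm b + 1))"]
  proof (rule eventually_mono)
    fix z assume z: "cmod z < 1 / (2 * (norm b + 1))"
    have "norm b + 1 > 0" by (simp add: add_nonneg_pos)
    then have "cmod z * (norm b + 1) < 1 / 2"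
      using z by (simp add: pos_less_divide_eq mult.commute mult.left_commute)
    moreover have "cmod z * norm b \<le> cmod z * (norm b + 1)"
      by (intro mult_left_mono) auto
    ultimately have n: "norm (cscal z * b) < 1 / 2"
      by (simp add: norm_cscal_mult)
    then obtain v where v: "is_inv (1 - cscal z * b) v" "norm v \<le> 1 / (1 - norm (cscal z * b))"
      using neumann_inverse[of "cscal z * b"] by force
    have "norm v \<le> 1 / (1 / 2)"
      using n by (intro order.trans[OF v(2)] divide_left_mono) auto
    moreover have "?v z = v" using v is_inv_unique by blast
    ultimately show "is_inv (1 - cscal z * b) (?v z) \<and> norm (?v z) \<le> 2"
      using v by simp
  qed (simp add: add_nonneg_pos)
  show ?thesis
  proof (rule inv_tameI)
    show "\<forall>\<^sub>F z in at 0. is_inv (cscal z - a) (p * R z - b * ?v z)"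
      using R(1) ev
    proof eventually_elim
      case (elim z)
      have R: "(cscal z - a * p) * R z = 1" "R z * (cscal z - a * p) = 1"
        and v: "(1 - cscal z * b) * ?v z = 1" "?v z * (1 - cscal z * b) = 1"
        using elim by (simp_all add: is_inv_def)
      have pap: "p * (a * p) = a * p" "(a * p) * p = a * p"
        using ap pp by (metis mult.assoc)+
      have e1: "(cscal z - a) * p = p * (cscal z - a * p)" "p * (cscal z - a) = (cscal z - a * p) * p"
        by (simp_all only: left_diff_distrib right_diff_distrib cscal_commute[of p] pap flip: ap)
      have "(a * b) * (cscal z * b) = cscal z * b"
        by (simp only: cscal_left_commute[of "a * b"] abb)
      then have e2: "(cscal z - a) * b = - (a * b * (1 - cscal z * b))"
        "b * (cscal z - a) = - ((1 - cscal z * b) * (a * b))"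
        by (simp_all add: left_diff_distrib right_diff_distrib cscal_commute[of b] mult.assoc[of "cscal z"] abb flip: ab)
      have "(cscal z - a) * (p * R z - b * ?v z) = ((cscal z - a) * p) * R z - ((cscal z - a) * b) * ?v z"
        by (simp only: right_diff_distrib mult.assoc)
      also have "\<dots> = p * ((cscal z - a * p) * R z) + a * b * ((1 - cscal z * b) * ?v z)"
        by (simp only: e1 e2) (simp add: mult.assoc)
      finally have r: "(cscal z - a) * (p * R z - b * ?v z) = 1"
        using R v by (simp add: p_def)
      \<comment> \<open>The left inverse has its factors in the opposite order. That the two
        one-sided inverses coincide follows from \<open>is_inv_left_right\<close>, so no commutation
        of \<open>R z\<close> with \<open>p\<close> has to be proved.\<close>
      have "(R z * p - ?v z * b) * (cscal z - a) = R z * (p * (cscal z - a)) - ?v z * (b * (cscal z - a))"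
        by (simp only: left_diff_distrib mult.assoc)
      also have "\<dots> = (R z * (cscal z - a * p)) * p + (?v z * (1 - cscal z * b)) * (a * b)"
        by (simp only: e1 e2) (simp add: mult.assoc)
      finally have "(R z * p - ?v z * b) * (cscal z - a) = 1"
        using R v by (simp add: p_def)
      then show ?case using r by (rule is_inv_left_right)
    qed
    assume pole
    have "\<forall>\<^sub>F z in at 0. norm (?v z) \<le> norm (2::real)"
      using ev by eventually_elim simp
    then have "tame ?v"
      by (rule tame_mono[OF tame_const])
    then have "tame (\<lambda>z. p * R z + (- b) * ?v z)"
      using R(2)[OF \<open>pole\<close>] by (intro tame_add tame_mult tame_const)
    then show "tame (\<lambda>z. p * R z - b * ?v z)" by simp
  qed
qed

lemma drazin_imp_inv_tame:
  assumes "drazin_invertible a"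
  shows "inv_tame True (\<lambda>z. cscal z - a)"
proof -
  obtain b n where "a * b = b * a" "b * a * b = b" "(a * (1 - a * b)) ^ n = 0"
    using assms unfolding drazin_invertible_def by blast
  then show ?thesis
    by (intro inv_tame_of_spectral_splitting[of a b] inv_tame_nilpotent[of _ n])
qed

lemma gdrazin_imp_inv_tame:
  assumes "gdrazin_invertible a"
  shows "inv_tame False (\<lambda>z. cscal z - a)"
proof -
  obtain b where "a * b = b * a" "b * a * b = b" "quasinilpotent (a * (1 - a * b))"
    using assms unfolding gdrazin_invertible_def by blast
  then show ?thesis
    by (intro inv_tame_of_spectral_splitting[of a b] inv_tame_quasinilpotent)
qed

subsection \<open>The Riesz idempotent as a limit of Riemann sums\<close>

text \<open>The sums with \<open>m\<close> and \<open>n\<close> nodes are both compared with the one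
  for the common refinement \<open>m * n\<close>, so the Cauchy property follows from uniform
  continuity without an integral.\<close>

lemma convergent_riemann_sums:
  fixes g :: "real \<Rightarrow> 'a::banach"
  assumes g: "continuous_on {0..1} g"
  shows "convergent (\<lambda>n. (\<Sum>k<n. g (real k / real n)) /\<^sub>R real n)"
proof -
  define S where "S n = (\<Sum>k<n. g (real k / real n)) /\<^sub>R real n" for n
  have "Cauchy S"
  proof (rule metric_CauchyI)
    fix e :: real assume e: "e > 0"
    obtain d where d: "d > 0" and gd: "\<And>x x'. x \<in> {0..1} \<Longrightarrow> x' \<in> {0..1} \<Longrightarrow> dist x' x < d \<Longrightarrow> dist (g x') (g x) < e / 3"
      using compact_uniformly_continuous[OF g] e unfolding uniformly_continuous_on_def
      by (metis compact_Icc divide_pos_pos zero_less_numeral)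
    obtain N :: nat where N: "N > 0" "1 / real N < d"
      using d by (metis nat_approx_posE of_nat_Suc zero_less_Suc)
    \<comment> \<open>The fine nodes are grouped into blocks of \<open>m\<close>: block
      \<open>i\<close> lies within \<open>1 / n\<close> to the right of the coarse node
      \<open>i / n\<close>, where \<open>g\<close> varies by less than \<open>e / 3\<close>.\<close>
    have refine: "dist (S n) (S (n * m)) \<le> e / 3" if n: "n \<ge> N" and m: "m > 0" for n m
    proof -
      have n0: "n > 0" using n N by simp
      have "real (n * m) *\<^sub>R S n = real m *\<^sub>R (\<Sum>i<n. g (real i / real n))"
        using n0 m by (simp add: S_def)
      also have "\<dots> = (\<Sum>i<n. \<Sum>k = i * m..<i * m + m. g (real i / real n))"
        by (simp add: scaleR_sum_right sum_constant_scaleR)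
      finally have "real (n * m) *\<^sub>R S n = (\<Sum>i<n. \<Sum>k = i * m..<i * m + m. g (real i / real n))" .
      moreover have "real (n * m) *\<^sub>R S (n * m) = (\<Sum>i<n. \<Sum>k = i * m..<i * m + m. g (real k / real (n * m)))"
        using n0 m unfolding S_def sum.nat_group by (simp del: of_nat_mult)
      ultimately have "norm (real (n * m) *\<^sub>R (S n - S (n * m))) =
          norm (\<Sum>i<n. \<Sum>k = i * m..<i * m + m. g (real i / real n) - g (real k / real (n * m)))"
        by (simp add: scaleR_diff_right sum_subtractf)
      also have "\<dots> \<le> (\<Sum>i<n. \<Sum>k = i * m..<i * m + m. e / 3)"
      proof (intro sum_norm_le)
        fix i k assume i: "i \<in> {..<n}" and k: "k \<in> {i * m..<i * m + m}"
        have "k < n * m"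
          using i k mult_le_mono1[of "Suc i" n m] by auto
        then have "real k / real (n * m) \<in> {0..1}"
          using n0 m by (simp del: of_nat_mult)
        moreover have "real i / real n \<in> {0..1}" using i by simp
        moreover have "dist (real i / real n) (real k / real (n * m)) < d"
        proof -
          have le: "real i * real m \<le> real k" "real k < real i * real m + real m"
            using k by (auto simp flip: of_nat_mult of_nat_add)
          have "real k / real (n * m) - real i / real n = (real k - real i * real m) / (real n * real m)"
            using n0 m by (simp add: field_simps)
          moreover have "0 \<le> (real k - real i * real m) / (real n * real m)"
            using le by simp
          moreover have "(real k - real i * real m) / (real n * real m) \<le> real m / (real n * real m)"
            using le by (intro divide_right_mono) auto
          moreover have "real m / (real n * real m) = 1 / real n" using m by simp
          moreover have "1 / real n \<le> 1 / real N"
            using n N n0 by (intro divide_left_mono) auto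
          ultimately show ?thesis using N(2) by (simp add: dist_real_def)
        qed
        ultimately show "norm (g (real i / real n) - g (real k / real (n * m))) \<le> e / 3"
          using gd by (simp add: dist_norm less_imp_le)
      qed
      also have "\<dots> = real (n * m) * (e / 3)" by simp
      finally have "real (n * m) * norm (S n - S (n * m)) \<le> real (n * m) * (e / 3)" by simp
      then show ?thesis using n0 m by (simp add: dist_norm)
    qed
    have "dist (S m) (S n) < e" if "m \<ge> N" "n \<ge> N" for m n
    proof -
      have "dist (S m) (S (m * n)) \<le> e / 3" "dist (S n) (S (m * n)) \<le> e / 3"
        using refine[of m n] refine[of n m] that N by (auto simp: mult.commute)
      then show ?thesis
        using dist_triangle2[of "S m" "S n" "S (m * n)"] e by simp
    qed
    then show "\<exists>M. \<forall>m\<ge>M. \<forall>n\<ge>M. dist (S m) (S n) < e" by blast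
  qed
  then show ?thesis by (simp add: Cauchy_convergent S_def[abs_def])
qed

section \<open>Averages over equidistant points of a circle\<close>

definition circ_point :: "real \<Rightarrow> nat \<Rightarrow> nat \<Rightarrow> complex" where
  "circ_point r n k = of_real r * cis (2 * pi * (real k / real n))"

text \<open>A Riemann sum for the contour integral of \<open>h z / z\<close> over the circle,
  divided by \<open>2 pi i\<close>. For \<open>n = 0\<close> it is 0, hence the hypotheses
  \<open>n > 0\<close>.\<close>

definition circ_avg :: "real \<Rightarrow> (complex \<Rightarrow> 'a::real_normed_vector) \<Rightarrow> nat \<Rightarrow> 'a" where
  "circ_avg r h n = (\<Sum>k<n. h (circ_point r n k)) /\<^sub>R real n"

lemma norm_circ_point [simp]: "r > 0 \<Longrightarrow> cmod (circ_point r n k) = r"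
  by (simp add: circ_point_def norm_mult)

lemma circ_point_neq_0 [simp]: "r > 0 \<Longrightarrow> circ_point r n k \<noteq> 0"
  by (simp add: circ_point_def)

lemma circ_point_power:
  assumes "n > 0"
  shows "circ_point r n k ^ n = of_real r ^ n"
proof -
  have "real n * (2 * pi * (real k / real n)) = 2 * pi * real k"
    using assms by simp
  then have "cis (2 * pi * (real k / real n)) ^ n = cis (2 * pi * real k)"
    by (simp only: Complex.DeMoivre)
  also have "\<dots> = 1" by (rule cis_multiple_2pi) simp
  finally show ?thesis by (simp add: circ_point_def power_mult_distrib)
qed

lemma circ_avg_cong:
  assumes "\<And>z. cmod z = r \<Longrightarrow> h z = h' z" "r > 0"
  shows "circ_avg r h n = circ_avg r h' n"
  using assms by (simp add: circ_avg_def)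

lemma circ_avg_mult_left: "x * circ_avg r h n = circ_avg r (\<lambda>z. x * h z :: 'a::real_normed_algebra) n"
  by (simp add: circ_avg_def sum_distrib_left)

lemma circ_avg_mult_right: "circ_avg r h n * x = circ_avg r (\<lambda>z. h z * x :: 'a::real_normed_algebra) n"
  by (simp add: circ_avg_def sum_distrib_right)

lemma circ_avg_diff: "circ_avg r (\<lambda>z. h z - h' z) n = circ_avg r h n - circ_avg r h' n"
  by (simp add: circ_avg_def sum_subtractf scaleR_diff_right)

lemma circ_avg_const: "n > 0 \<Longrightarrow> circ_avg r (\<lambda>z. c) n = c"
  by (simp add: circ_avg_def sum_constant_scaleR)

text \<open>Two radii are allowed so that the dependence of averages on the radius can be estimated;
  taking \<open>h' = 0\<close> gives the usual bound of an average by a supremum.\<close>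

lemma circ_avg_diff_norm_le:
  assumes "\<And>\<omega>. cmod \<omega> = 1 \<Longrightarrow> norm (h (of_real r * \<omega>) - h' (of_real s * \<omega>)) \<le> M" "n > 0"
  shows "norm (circ_avg r h n - circ_avg s h' n) \<le> M"
proof -
  have "norm (\<Sum>k<n. h (circ_point r n k) - h' (circ_point s n k)) \<le> (\<Sum>k<n. M)"
    by (intro sum_norm_le) (simp add: circ_point_def assms(1))
  then have "norm (\<Sum>k<n. h (circ_point r n k) - h' (circ_point s n k)) / real n \<le> M"
    using assms(2) by (simp add: pos_divide_le_eq mult.commute)
  moreover have "circ_avg r h n - circ_avg s h' n = (\<Sum>k<n. h (circ_point r n k) - h' (circ_point s n k)) /\<^sub>R real n"
    by (simp add: circ_avg_def sum_subtractf scaleR_diff_right)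
  ultimately show ?thesis
    by (simp add: divide_inverse_commute)
qed

lemma circ_avg_norm_le:
  assumes "\<And>z. cmod z = r \<Longrightarrow> norm (h z) \<le> M" "n > 0" "r > 0"
  shows "norm (circ_avg r h n) \<le> M"
  using circ_avg_diff_norm_le[of h r "\<lambda>_. 0" r M n] assms
  by (simp add: circ_avg_const norm_mult)

lemma convergent_circ_avg:
  fixes h :: "complex \<Rightarrow> 'a::banach"
  assumes "continuous_on (sphere 0 r) h" "r > 0"
  shows "convergent (circ_avg r h)"
proof -
  have "continuous_on {0..1} (\<lambda>t. h (of_real r * cis (2 * pi * t)))"
    by (rule continuous_on_compose2[OF assms(1)])
       (use assms(2) in \<open>auto intro!: continuous_intros simp: norm_mult\<close>)
  from convergent_riemann_sums[OF this] show ?thesis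
    by (simp add: circ_avg_def[abs_def] circ_point_def)
qed

text \<open>Orthogonality of the powers on the \<open>n\<close>-th roots of unity: for
  \<open>j \<noteq> k\<close> below \<open>n\<close>, the terms form a geometric progression whose
  ratio is an \<open>n\<close>-th root of unity other than 1.\<close>

lemma sum_circ_point_power:
  assumes "r > 0" "k < n" "j < n"
  shows "(\<Sum>m<n. circ_point r n m ^ k * inverse (circ_point r n m) ^ j) = (if j = k then of_nat n else 0)"
proof (cases "j = k")
  case True
  then show ?thesis using assms by (simp flip: power_mult_distrib)
next
  case False
  define \<zeta> where "\<zeta> i = cis (2 * pi * real i / real n)" for i
  define \<eta> where "\<eta> = \<zeta> k * inverse (\<zeta> j)"
  have n: "n > 0" using assms by simp
  have "inj_on \<zeta> {..<n}"
    using Complex.bij_betw_roots_unity[OF n] unfolding \<zeta>_def bij_betw_def by simp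
  then have "\<zeta> k \<noteq> \<zeta> j" using False assms by (auto simp: inj_on_def)
  moreover have \<zeta>0: "\<zeta> i \<noteq> 0" for i by (simp add: \<zeta>_def)
  ultimately have \<eta>1: "\<eta> \<noteq> 1" by (simp add: \<eta>_def field_simps)
  have \<zeta>n: "\<zeta> i ^ n = 1" for i
    using circ_point_power[OF n, of 1 i] by (simp add: \<zeta>_def circ_point_def)
  then have \<eta>n: "\<eta> ^ n = 1" by (simp add: \<eta>_def power_mult_distrib power_inverse)
  have "circ_point r n m ^ k * inverse (circ_point r n m) ^ j = of_real (r ^ k * inverse r ^ j) * \<eta> ^ m" for m
  proof -
    \<comment> \<open>Exponent and index change roles here: the \<open>i\<close>-th power of the
      \<open>m\<close>-th root is the \<open>m\<close>-th power of the \<open>i\<close>-th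
      root.\<close>
    define c where "c = cis (2 * pi * (real m / real n))"
    have "c ^ i = \<zeta> i ^ m" for i
    proof -
      have "real i * (2 * pi * (real m / real n)) = real m * (2 * pi * real i / real n)" by simp
      then show ?thesis by (simp only: c_def \<zeta>_def Complex.DeMoivre)
    qed
    moreover have "circ_point r n m = of_real r * c" by (simp add: circ_point_def c_def)
    ultimately show ?thesis
      by (simp add: \<eta>_def power_mult_distrib power_inverse)
  qed
  then have "(\<Sum>m<n. circ_point r n m ^ k * inverse (circ_point r n m) ^ j) =
      of_real (r ^ k * inverse r ^ j) * (\<Sum>m<n. \<eta> ^ m)"
    by (simp add: sum_distrib_left)
  then show ?thesis using False by (simp add: geometric_sum[OF \<eta>1] \<eta>n)
qed

section \<open>The Riesz idempotent and its approximants\<close>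

definition resolvent_circle :: "'a::complex_banach_algebra_1 \<Rightarrow> real \<Rightarrow> bool" where
  "resolvent_circle a r \<longleftrightarrow> r > 0 \<and> (\<forall>z. cmod z = r \<longrightarrow> alg_invertible (cscal z - a))"

text \<open>The factor \<open>z\<close> comes from \<open>dz = i z dt\<close>: these are Riemann
  sums for the contour integral of the resolvent divided by \<open>2 pi i\<close>.\<close>

definition riesz_approx :: "'a::complex_banach_algebra_1 \<Rightarrow> real \<Rightarrow> nat \<Rightarrow> 'a" where
  "riesz_approx a r = circ_avg r (\<lambda>z. cscal z * resolv a z)"

definition riesz :: "'a::complex_banach_algebra_1 \<Rightarrow> real \<Rightarrow> 'a" where
  "riesz a r = lim (riesz_approx a r)"

definition scaled_power :: "'a::complex_banach_algebra_1 \<Rightarrow> real \<Rightarrow> nat \<Rightarrow> 'a" where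
  "scaled_power a r n = cscal (inverse (of_real r) ^ n) * a ^ n"

lemma riesz_approx_tendsto:
  assumes "resolvent_circle a r"
  shows "riesz_approx a r \<longlonglongrightarrow> riesz a r"
proof -
  have "continuous_on (sphere 0 r) (\<lambda>z. cscal z * resolv a z)"
    using assms by (intro continuous_intros continuous_on_resolv) (auto simp: resolvent_circle_def)
  then have "convergent (riesz_approx a r)"
    using assms unfolding riesz_approx_def resolvent_circle_def by (intro convergent_circ_avg) auto
  then show ?thesis
    by (simp add: convergent_LIMSEQ_iff riesz_def)
qed

text \<open>At every node \<open>z^n = r^n\<close>, so telescoping turns
  \<open>z (z - a)^(-1) (1 - (a / r)^n)\<close> into the finite sum of the \<open>(a / z)^j\<close>.
  After multiplication by \<open>z ^ k\<close> and averaging, orthogonality leaves only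
  \<open>j = k\<close>.\<close>

lemma circ_avg_resolv_mult:
  assumes a: "resolvent_circle a r" and k: "k < n"
  shows "circ_avg r (\<lambda>z. cscal (z ^ k) * (cscal z * resolv a z)) n * (1 - scaled_power a r n) = a ^ k"
proof -
  have r: "r > 0" and n: "n > 0" using a k by (auto simp: resolvent_circle_def)
  have pt: "(cscal (z ^ k) * (cscal z * resolv a z)) * (1 - scaled_power a r n) =
      (\<Sum>j<n. cscal (z ^ k * inverse z ^ j) * a ^ j)" if z: "z = circ_point r n m" for z m
  proof -
    have z0: "z \<noteq> 0" and zr: "cmod z = r" using r by (simp_all add: z)
    have "inverse z ^ n = inverse (of_real r) ^ n"
      using circ_point_power[OF n] by (simp add: z power_inverse)
    then have "(cscal z - a) * (\<Sum>j<n. cscal (inverse z ^ j) * a ^ j) = cscal z * (1 - scaled_power a r n)"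
      using resolvent_telescope(1)[OF z0, of a n] by (simp add: scaled_power_def)
    then have "resolv a z * (cscal z * (1 - scaled_power a r n)) =
       (resolv a z * (cscal z - a)) * (\<Sum>j<n. cscal (inverse z ^ j) * a ^ j)"
      by (simp only: mult.assoc)
    moreover have "resolv a z * (cscal z - a) = 1"
      using is_inv_resolv[of z a] a zr by (simp add: resolvent_circle_def is_inv_def)
    ultimately have "cscal z * resolv a z * (1 - scaled_power a r n) = (\<Sum>j<n. cscal (inverse z ^ j) * a ^ j)"
      by (simp only: mult_1_left cscal_left_commute[of "resolv a z"] mult.assoc)
    then show ?thesis
      by (simp add: sum_distrib_left mult.assoc cscal_mult)
  qed
  have "(\<Sum>m<n. (\<Sum>j<n. cscal (circ_point r n m ^ k * inverse (circ_point r n m) ^ j) * a ^ j)) =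
      (\<Sum>j<n. cscal (\<Sum>m<n. circ_point r n m ^ k * inverse (circ_point r n m) ^ j) * a ^ j)"
    by (subst sum.swap) (simp add: cscal_sum sum_distrib_right)
  also have "\<dots> = (\<Sum>j<n. if j = k then cscal (of_nat n) * a ^ j else 0)"
    using k r by (intro sum.cong) (auto simp: sum_circ_point_power)
  also have "\<dots> = real n *\<^sub>R a ^ k"
    using k by (simp add: scaleR_conv_of_real flip: cscal_of_real)
  finally show ?thesis
    using n unfolding circ_avg_mult_right by (simp add: circ_avg_def pt)
qed

lemma riesz_approx_commute:
  assumes "resolvent_circle a r" "a * x = x * a"
  shows "riesz_approx a r n * x = x * riesz_approx a r n"
  unfolding riesz_approx_def circ_avg_mult_left circ_avg_mult_right
proof (rule circ_avg_cong)
  fix z assume "cmod z = r"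
  then have "resolv a z * x = x * resolv a z"
    using assms by (intro resolv_commute) (auto simp: resolvent_circle_def)
  then show "cscal z * resolv a z * x = x * (cscal z * resolv a z)"
    by (simp add: mult.assoc cscal_left_commute[of x])
qed (use assms in \<open>simp add: resolvent_circle_def\<close>)

lemma scaled_power_commute: "a * scaled_power a r n = scaled_power a r n * a"
  by (simp add: scaled_power_def cscal_left_commute[of a] mult.assoc power_commutes)

lemma is_inv_riesz_approx:
  assumes "resolvent_circle a r" "n > 0"
  shows "is_inv (1 - scaled_power a r n) (riesz_approx a r n)"
proof -
  have "riesz_approx a r n * (1 - scaled_power a r n) = 1"
    using circ_avg_resolv_mult[OF assms] by (simp add: riesz_approx_def)
  moreover have "riesz_approx a r n * (1 - scaled_power a r n) = (1 - scaled_power a r n) * riesz_approx a r n"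
    by (intro riesz_approx_commute assms) (simp add: algebra_simps scaled_power_commute)
  ultimately show ?thesis by (simp add: is_inv_def)
qed

text \<open>Discrete form of the functional calculus formula for \<open>a ^ k\<close> times the
  Riesz idempotent; it transfers bounds on the resolvent to powers of \<open>a\<close>.\<close>

lemma circ_avg_eq_power_mult_riesz_approx:
  assumes "resolvent_circle a r" "k < n"
  shows "circ_avg r (\<lambda>z. cscal (z ^ k) * (cscal z * resolv a z)) n = a ^ k * riesz_approx a r n"
proof -
  let ?A = "circ_avg r (\<lambda>z. cscal (z ^ k) * (cscal z * resolv a z)) n"
  have "?A = ?A * ((1 - scaled_power a r n) * riesz_approx a r n)"
    using is_inv_riesz_approx[OF assms(1), of n] assms(2) by (simp add: is_inv_def)
  also have "\<dots> = a ^ k * riesz_approx a r n"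
    using circ_avg_resolv_mult[OF assms] by (simp flip: mult.assoc)
  finally show ?thesis .
qed

text \<open>With \<open>y = (a / r)^n\<close>, the approximants are the inverses of
  \<open>1 - y\<close> and of \<open>1 - y * y = (1 - y) * (1 + y)\<close>. This expresses the first
  through the second and yields a quadratic relation that becomes idempotency in the limit.\<close>

lemma riesz_idem:
  assumes a: "resolvent_circle a r"
  shows "riesz a r * riesz a r = riesz a r"
proof -
  let ?f = "riesz_approx a r"
  have rel: "?f (2 * n) = ?f n * (2 * ?f (2 * n) - ?f n)" if n: "n > 0" for n
  proof -
    define y where "y = scaled_power a r n"
    have "scaled_power a r (2 * n) = y * y"
      by (simp add: y_def scaled_power_def mult_2 power_add cscal_mult mult.assoc cscal_left_commute[of "a ^ n"])
    then have f: "is_inv (1 - y) (?f n)" and f2: "is_inv (1 - y * y) (?f (2 * n))"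
      using is_inv_riesz_approx[OF a] n by (metis y_def, metis mult_pos_pos zero_less_numeral)
    have "?f n = ?f n * ((1 - y * y) * ?f (2 * n))" using f2 by (simp add: is_inv_def)
    also have "(1 - y * y) = (1 - y) * (1 + y)" by (simp add: algebra_simps)
    also have "?f n * ((1 - y) * (1 + y) * ?f (2 * n)) = (?f n * (1 - y)) * ((1 + y) * ?f (2 * n))"
      by (simp only: mult.assoc)
    finally have fn: "?f n = (1 + y) * ?f (2 * n)" using f by (simp add: is_inv_def)
    have "?f n * (2 * ?f (2 * n) - ?f n) = ?f n * (2 * ?f (2 * n) - (1 + y) * ?f (2 * n))"
      by (subst (2) fn) (rule refl)
    also have "2 * ?f (2 * n) - (1 + y) * ?f (2 * n) = (1 - y) * ?f (2 * n)"
      by (simp add: algebra_simps mult_2)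
    also have "?f n * ((1 - y) * ?f (2 * n)) = ?f (2 * n)"
      using f by (simp add: is_inv_def flip: mult.assoc)
    finally show ?thesis by simp
  qed
  have lim: "?f \<longlonglongrightarrow> riesz a r" by (rule riesz_approx_tendsto[OF a])
  have lim2: "(\<lambda>n. ?f (2 * n)) \<longlonglongrightarrow> riesz a r"
    using LIMSEQ_subseq_LIMSEQ[OF lim, of "\<lambda>n. 2 * n"] by (simp add: strict_mono_def comp_def)
  have "(\<lambda>n. ?f n * (2 * ?f (2 * n) - ?f n)) \<longlonglongrightarrow> riesz a r * (2 * riesz a r - riesz a r)"
    by (intro tendsto_intros lim lim2)
  moreover have "\<forall>\<^sub>F n in sequentially. ?f n * (2 * ?f (2 * n) - ?f n) = ?f (2 * n)"
    using eventually_gt_at_top[of 0] by eventually_elim (use rel in simp)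
  ultimately have "(\<lambda>n. ?f (2 * n)) \<longlonglongrightarrow> riesz a r * (2 * riesz a r - riesz a r)"
    using tendsto_cong by fast
  then have "riesz a r = riesz a r * (2 * riesz a r - riesz a r)"
    using lim2 LIMSEQ_unique by blast
  then show ?thesis by (simp add: mult_2)
qed

lemma riesz_commute:
  assumes "resolvent_circle a r" "a * x = x * a"
  shows "riesz a r * x = x * riesz a r"
proof -
  have "(\<lambda>n. riesz_approx a r n * x) \<longlonglongrightarrow> riesz a r * x"
    "(\<lambda>n. x * riesz_approx a r n) \<longlonglongrightarrow> x * riesz a r"
    by (intro tendsto_intros riesz_approx_tendsto[OF assms(1)])+
  then show ?thesis
    using riesz_approx_commute[OF assms] LIMSEQ_unique by simp
qed

subsection \<open>Drazin inverses and the resolvent near the origin\<close>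

lemma quasinilpotent_iff: "quasinilpotent a \<longleftrightarrow> (\<forall>z. z \<noteq> 0 \<longrightarrow> alg_invertible (cscal z - a))"
  by (auto simp: quasinilpotent_def alg_spectrum_def)

text \<open>Only some power of \<open>c / z\<close> has to be small: the Neumann series inverts
  \<open>1 - (c / z)^n\<close>, and the telescoped sum carries this over to
  \<open>z - c\<close>.\<close>

lemma alg_invertible_of_norm_power_less:
  fixes c :: "'a::complex_banach_algebra_1"
  assumes z: "z \<noteq> 0" and c: "norm (cscal (inverse z ^ n) * c ^ n) < 1"
  shows "alg_invertible (cscal z - c)"
proof -
  obtain v where v: "is_inv (1 - cscal (inverse z ^ n) * c ^ n) v"
    using neumann_inverse[OF c] .
  let ?S = "\<Sum>j<n. cscal (inverse z ^ j) * c ^ j"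
  obtain w where w: "is_inv (cscal z * (1 - cscal (inverse z ^ n) * c ^ n)) w"
    using is_inv_mult[OF is_inv_cscal[OF z] v] by blast
  have "(cscal z - c) * (?S * w) = 1"
    using w resolvent_telescope(1)[OF z, of c n] by (simp add: is_inv_def flip: mult.assoc)
  moreover have "(w * ?S) * (cscal z - c) = 1"
    using w resolvent_telescope(2)[OF z, of c n] by (simp add: is_inv_def mult.assoc)
  ultimately show ?thesis
    using is_inv_left_right alg_invertible_iff by blast
qed

text \<open>The element \<open>a * (1 - a * b)\<close> agrees with \<open>a\<close> on the part of
  \<open>1 - a * b\<close> and vanishes on the part of \<open>a * b\<close>; the inverse is
  therefore \<open>R\<close> on the former and \<open>1 / z\<close> on the latter.\<close>

lemma is_inv_spectral_part:
  assumes ab: "a * b = b * a" and bab: "b * a * b = b"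
    and R: "is_inv (cscal z - a) R" and z: "z \<noteq> 0"
  shows "is_inv (cscal z - a * (1 - a * b)) (R * (1 - a * b) + cscal (inverse z) * (a * b))"
proof -
  define e where "e = a * b"
  have ee: "e * e = e" unfolding e_def by (metis bab mult.assoc)
  have ae: "a * e = e * a" unfolding e_def by (metis ab mult.assoc)
  then have "(cscal z - a) * e = e * (cscal z - a)"
    by (simp add: algebra_simps cscal_commute)
  then have Re: "R * e = e * R" by (rule is_inv_commute[OF R])
  have split: "cscal z - a * (1 - e) = (cscal z - a) * (1 - e) + cscal z * e"
    by (simp add: algebra_simps)
  have pp: "(1 - e) * (1 - e) = 1 - e" "(1 - e) * e = 0" "e * (1 - e) = 0"
    by (simp_all add: algebra_simps ee)
  have cp: "(1 - e) * (cscal z - a) = (cscal z - a) * (1 - e)"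
    by (simp add: algebra_simps cscal_commute[of e] ae)
  have Rp: "R * (1 - e) = (1 - e) * R" by (simp add: algebra_simps Re)
  have R1: "(cscal z - a) * R = 1" "R * (cscal z - a) = 1" using R by (simp_all add: is_inv_def)
  let ?X = "(cscal z - a) * (1 - e)" and ?Y = "cscal z * e"
  let ?X' = "R * (1 - e)" and ?Y' = "cscal (inverse z) * e"
  have 1: "?X * ?X' = 1 - e"
  proof -
    have "?X * ?X' = ((cscal z - a) * R) * ((1 - e) * (1 - e))" by (simp only: Rp mult.assoc) (metis Rp mult.assoc)
    then show ?thesis by (simp only: R1 pp mult_1_left)
  qed
  have 2: "?X' * ?X = 1 - e"
  proof -
    have "?X' * ?X = R * ((1 - e) * (cscal z - a)) * (1 - e)" by (simp only: mult.assoc)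
    also have "\<dots> = (R * (cscal z - a)) * ((1 - e) * (1 - e))" by (simp only: cp mult.assoc)
    finally show ?thesis by (simp only: R1 pp mult_1_left)
  qed
  have 3: "?Y * ?Y' = e" "?Y' * ?Y = e"
    using z by (simp_all add: mult.assoc cscal_left_commute[of e] ee) (simp_all flip: mult.assoc)
  have 4: "?X * ?Y' = 0" "?X' * ?Y = 0" "?Y * ?X' = 0" "?Y' * ?X = 0"
  proof -
    show "?X * ?Y' = 0" "?X' * ?Y = 0"
      by (simp_all only: mult.assoc cscal_left_commute[of "1 - e"] pp mult_zero_right)
    have "?Y * ?X' = cscal z * ((e * (1 - e)) * R)" by (simp only: Rp mult.assoc)
    then show "?Y * ?X' = 0" by (simp add: pp)
    have "?Y' * ?X = cscal (inverse z) * ((e * (1 - e)) * (cscal z - a))" by (simp only: cp mult.assoc)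
    then show "?Y' * ?X = 0" by (simp add: pp)
  qed
  have "(?X + ?Y) * (?X' + ?Y') = 1" "(?X' + ?Y') * (?X + ?Y) = 1"
    by (simp_all only: distrib_left distrib_right 1 2 3 4) simp_all
  then show ?thesis
    unfolding is_inv_def split[symmetric] by (simp add: e_def)
qed

text \<open>The Riesz idempotent \<open>P\<close> of the circle serves as \<open>1 - a * b\<close>.
  Quasinilpotency of \<open>a * P\<close> comes from the spectral splitting inside the circle and
  from decay of powers outside.\<close>

lemma ex_gdrazin_inverse:
  fixes a :: "'a::complex_banach_algebra_1"
  assumes r: "r > 0" and inv: "\<And>z. 0 < cmod z \<Longrightarrow> cmod z \<le> r \<Longrightarrow> alg_invertible (cscal z - a)"
  shows "\<exists>b. a * b = b * a \<and> b * a * b = b \<and> quasinilpotent (a * (1 - a * b))"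
proof -
  have a: "resolvent_circle a r" unfolding resolvent_circle_def using r inv by (metis order_refl)
  define P where "P = riesz a r"
  have PP: "P * P = P" unfolding P_def by (rule riesz_idem[OF a])
  have aP: "P * a = a * P" unfolding P_def by (rule riesz_commute[OF a refl])
  let ?f = "riesz_approx a r" and ?g = "circ_avg r (resolv a)"
  \<comment> \<open>The limit stands for the contour integral of \<open>resolv a z / z\<close>.
    Averaging \<open>a * resolv a z = z * resolv a z - 1\<close> gives \<open>a * G = P - 1\<close>,
    so \<open>- G\<close> inverts \<open>a\<close> on the part of \<open>1 - P\<close>.\<close>
  define G where "G = lim ?g"
  have "convergent ?g"
    using a by (intro convergent_circ_avg continuous_on_resolv) (auto simp: resolvent_circle_def)
  then have g: "?g \<longlonglongrightarrow> G" by (simp add: G_def convergent_LIMSEQ_iff)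
  have f: "?f \<longlonglongrightarrow> P" unfolding P_def by (rule riesz_approx_tendsto[OF a])
  have ag: "a * ?g n = ?f n - 1" "a * ?g n = ?g n * a" if "n > 0" for n
  proof -
    have "a * ?g n = circ_avg r (\<lambda>z. cscal z * resolv a z - 1) n"
      unfolding circ_avg_mult_left
      using a by (intro circ_avg_cong mult_resolv) (auto simp: resolvent_circle_def)
    then show "a * ?g n = ?f n - 1"
      using that by (simp add: circ_avg_diff circ_avg_const riesz_approx_def)
    show "a * ?g n = ?g n * a"
      unfolding circ_avg_mult_left circ_avg_mult_right
      using a by (intro circ_avg_cong resolv_commute[symmetric]) (auto simp: resolvent_circle_def)
  qed
  have ev: "\<forall>\<^sub>F n in sequentially. a * ?g n = ?f n - 1" "\<forall>\<^sub>F n in sequentially. a * ?g n = ?g n * a"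
    using eventually_gt_at_top[of 0] by (eventually_elim, use ag in blast)+
  have lims: "(\<lambda>n. a * ?g n) \<longlonglongrightarrow> a * G" "(\<lambda>n. ?f n - 1) \<longlonglongrightarrow> P - 1" "(\<lambda>n. ?g n * a) \<longlonglongrightarrow> G * a"
    by (intro tendsto_intros f g)+
  have aG: "a * G = P - 1" "a * G = G * a"
    using LIMSEQ_unique[OF lims(1)] lims(2,3) tendsto_cong[OF ev(1)] tendsto_cong[OF ev(2)] by metis+
  \<comment> \<open>The factor \<open>1 - P\<close> removes the component of \<open>- G\<close> on
    the part of \<open>P\<close>, which makes \<open>b * a * b = b\<close> hold.\<close>
  define b where "b = - G * (1 - P)"
  have ab: "a * b = 1 - P"
  proof -
    have "a * b = - (a * G) * (1 - P)" by (simp add: b_def mult.assoc)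
    also have "\<dots> = 1 - P" by (simp add: aG(1) algebra_simps PP)
    finally show ?thesis .
  qed
  have ba: "b * a = 1 - P"
  proof -
    have "b * a = - G * ((1 - P) * a)" by (simp only: b_def mult.assoc)
    also have "(1 - P) * a = a * (1 - P)" by (simp add: algebra_simps aP)
    also have "- G * (a * (1 - P)) = - (G * a) * (1 - P)" by (simp add: mult.assoc)
    also have "G * a = P - 1" using aG by simp
    also have "- (P - 1) * (1 - P) = 1 - P" by (simp add: algebra_simps PP)
    finally show ?thesis .
  qed
  have bab: "b * a * b = b"
  proof -
    have "b * a * b = b * (1 - P)" by (simp only: ab mult.assoc)
    also have "\<dots> = - G * ((1 - P) * (1 - P))" by (simp only: b_def mult.assoc)
    also have "(1 - P) * (1 - P) = 1 - P" by (simp add: algebra_simps PP)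
    finally show ?thesis by (simp add: b_def)
  qed
  have "quasinilpotent (a * P)"
    unfolding quasinilpotent_iff
  proof (intro allI impI)
    fix w :: complex assume w: "w \<noteq> 0"
    show "alg_invertible (cscal w - a * P)"
    proof (cases "cmod w \<le> r")
      case True
      then have "is_inv (cscal w - a) (resolv a w)" using w by (intro is_inv_resolv inv) auto
      from is_inv_spectral_part[OF _ bab this w] show ?thesis
        using ab ba by (auto simp: alg_invertible_iff)
    next
      case False
      \<comment> \<open>Outside the circle: \<open>(aP/r)\<^sup>n\<close> tends to 0 because \<open>(a/r)\<^sup>n f\<^sub>n = f\<^sub>n - 1\<close>.\<close>
      have "(\<lambda>n. (?f n - 1) * P) \<longlonglongrightarrow> (P - 1) * P"
        by (intro tendsto_intros f)
      then have "(\<lambda>n. (?f n - 1) * P) \<longlonglongrightarrow> 0" by (simp add: algebra_simps PP)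
      from order_tendstoD(2)[OF tendsto_norm[OF this], of "1 / 3"]
      have "\<forall>\<^sub>F n in sequentially. norm ((?f n - 1) * P) < 1 / 3" by simp
      then have "\<forall>\<^sub>F n in sequentially. norm ((?f n - 1) * P) < 1 / 3 \<and> n > 0"
        using eventually_gt_at_top[of 0] by eventually_elim simp
      then obtain n where n: "norm ((?f n - 1) * P) < 1 / 3" "n > 0"
        by (auto simp: eventually_sequentially)
      define y where "y = scaled_power a r n"
      define e where "e = (?f n - 1) * P"
      have f1: "?f n - 1 = y * ?f n"
        using is_inv_riesz_approx[OF a n(2)] by (simp add: is_inv_def y_def algebra_simps)
      have fP: "?f n * P = P * ?f n"
        using aP by (intro riesz_approx_commute[OF a]) simp
      \<comment> \<open>The goal is \<open>e = y * P + (y * P) * e\<close>. Since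
        \<open>norm e < 1 / 3\<close>, the last term can be absorbed, which gives
        \<open>norm (y * P) \<le> 1 / 2\<close>.\<close>
      have "e = y * (?f n * P)" by (simp add: e_def f1 mult.assoc)
      also have "?f n * P = P * ?f n * P" using fP PP by (metis mult.assoc)
      also have "P * ?f n * P = P * (P + e)" by (simp add: e_def algebra_simps PP)
      also have "y * (P * (P + e)) = (y * P) * P + (y * P) * e" by (simp only: distrib_left mult.assoc)
      also have "(y * P) * P = y * P" by (simp add: mult.assoc PP)
      finally have "y * P = e - (y * P) * e" by (metis add_diff_cancel_right')
      then have "norm (y * P) \<le> norm e + norm ((y * P) * e)"
        by (metis norm_triangle_ineq4)
      also have "\<dots> \<le> norm e + norm (y * P) * norm e"
        by (intro add_left_mono norm_mult_ineq)
      also have "\<dots> \<le> 1 / 3 + norm (y * P) * (1 / 3)"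
        using n by (intro add_mono mult_left_mono) (auto simp: e_def)
      finally have yP: "norm (y * P) < 1" by simp
      \<comment> \<open>The induction starts at 1, since at exponent 0 the two sides are 1 and
        \<open>P\<close>.\<close>
      have "(a * P) ^ n = a ^ n * P" using n(2)
      proof (induction n rule: nat_induct_non_zero)
        case (Suc n)
        have "(a * P) ^ Suc n = a * (P * a ^ n) * P" by (simp add: Suc mult.assoc)
        also have "P * a ^ n = a ^ n * P" using power_commuting_commutes[of a P n] aP by simp
        finally show ?case by (simp add: mult.assoc PP)
      qed simp
      moreover have "inverse w = (of_real r * inverse w) * inverse (of_real r)"
        using r by simp
      then have "inverse w ^ n = (of_real r * inverse w) ^ n * inverse (of_real r) ^ n"
        by (metis power_mult_distrib)
      ultimately have eq: "cscal (inverse w ^ n) * (a * P) ^ n = cscal ((of_real r * inverse w) ^ n) * (y * P)"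
        by (simp only: y_def scaled_power_def cscal_mult mult.assoc)
      have "cmod (of_real r * inverse w) \<le> 1"
        using False r w by (simp add: norm_divide flip: divide_inverse)
      then have "cmod ((of_real r * inverse w) ^ n) \<le> 1"
        unfolding norm_power by (intro power_le_one) auto
      then have "norm (cscal (inverse w ^ n) * (a * P) ^ n) \<le> 1 * norm (y * P)"
        unfolding eq norm_cscal_mult by (intro mult_right_mono) auto
      then show ?thesis
        using yP w by (intro alg_invertible_of_norm_power_less[of w n]) auto
    qed
  qed
  then show ?thesis using ab ba bab by (intro exI[of _ b]) simp
qed

text \<open>The powers \<open>(q / r)^n\<close> tend to 0, so the inverses of
  \<open>1 - (q / r)^n\<close> tend to 1.\<close>

lemma riesz_eq_1_of_norm_less:
  assumes q: "resolvent_circle q r" and r: "norm q < r"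
  shows "riesz q r = 1"
proof -
  have r0: "r > 0" using q by (simp add: resolvent_circle_def)
  have "(\<lambda>n. (norm q / r) ^ n) \<longlonglongrightarrow> 0"
    using r r0 by (intro LIMSEQ_power_zero) simp
  moreover have "norm (scaled_power q r n) \<le> (norm q / r) ^ n" for n
  proof -
    have "norm (scaled_power q r n) \<le> inverse r ^ n * norm q ^ n"
      unfolding scaled_power_def norm_cscal_mult using r0
      by (simp add: norm_power norm_inverse norm_power_ineq)
    then show ?thesis by (simp add: divide_inverse power_mult_distrib mult.commute)
  qed
  ultimately have "scaled_power q r \<longlonglongrightarrow> 0"
    using Lim_null_comparison[OF always_eventually] by blast
  then have "(\<lambda>n. (1 - scaled_power q r n) * riesz_approx q r n) \<longlonglongrightarrow> (1 - 0) * riesz q r"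
    by (intro tendsto_intros riesz_approx_tendsto[OF q])
  moreover have "\<forall>\<^sub>F n in sequentially. (1 - scaled_power q r n) * riesz_approx q r n = 1"
    using eventually_gt_at_top[of 0]
    by eventually_elim (use is_inv_riesz_approx[OF q] in \<open>simp add: is_inv_def\<close>)
  ultimately have "(\<lambda>n::nat. 1) \<longlonglongrightarrow> riesz q r"
    using tendsto_cong by force
  then show ?thesis using LIMSEQ_unique[OF tendsto_const] by metis
qed

text \<open>Uniform continuity of \<open>z * resolv a z\<close> on the closed annulus bounds the
  difference of the approximants for nearby radii, uniformly in \<open>n\<close>; the bound passes
  to the limit.\<close>

lemma continuous_on_riesz:
  fixes a :: "'a::complex_banach_algebra_1"
  assumes s: "0 < s" and a: "\<And>r. r \<in> {s..t} \<Longrightarrow> resolvent_circle a r"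
  shows "continuous_on {s..t} (riesz a)"
proof -
  let ?K = "cball 0 t - ball (0::complex) s"
  let ?F = "\<lambda>z. cscal z * resolv a z"
  have K: "compact ?K" by (intro compact_diff compact_cball open_ball)
  have "alg_invertible (cscal z - a)" if "z \<in> ?K" for z
    using a[of "cmod z"] that by (simp add: resolvent_circle_def)
  then have "continuous_on ?K ?F"
    by (intro continuous_intros continuous_on_resolv)
  then have u: "uniformly_continuous_on ?K ?F" by (rule compact_uniformly_continuous[OF _ K])
  show ?thesis
    unfolding continuous_on_iff
  proof (intro ballI allI impI)
    fix r and e :: real assume r: "r \<in> {s..t}" and e: "e > 0"
    then obtain d where d: "d > 0" and F: "\<And>x x'. x \<in> ?K \<Longrightarrow> x' \<in> ?K \<Longrightarrow> dist x' x < d \<Longrightarrow> dist (?F x') (?F x) < e / 2"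
      using u unfolding uniformly_continuous_on_def by (metis half_gt_zero)
    have "dist (riesz a r') (riesz a r) < e" if r': "r' \<in> {s..t}" "dist r' r < d" for r'
    proof -
      have "norm (riesz_approx a r' n - riesz_approx a r n) \<le> e / 2" if n: "n > 0" for n
        unfolding riesz_approx_def
      proof (rule circ_avg_diff_norm_le)
        fix \<omega> :: complex assume \<omega>: "cmod \<omega> = 1"
        have "dist (of_real r' * \<omega>) (of_real r * \<omega>) = dist r' r"
          using \<omega> by (simp add: dist_norm norm_mult flip: left_diff_distrib of_real_diff)
        moreover have "of_real r' * \<omega> \<in> ?K" "of_real r * \<omega> \<in> ?K"
          using \<omega> r r' s by (auto simp: norm_mult)
        ultimately have "dist (?F (of_real r' * \<omega>)) (?F (of_real r * \<omega>)) < e / 2"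
          using F r' by simp
        then show "norm (?F (of_real r' * \<omega>) - ?F (of_real r * \<omega>)) \<le> e / 2"
          by (simp add: dist_norm)
      qed (rule n)
      then have "\<forall>\<^sub>F n in sequentially. norm (riesz_approx a r' n - riesz_approx a r n) \<le> e / 2"
        using eventually_gt_at_top[of 0] by (rule eventually_mono[rotated])
      moreover have "(\<lambda>n. norm (riesz_approx a r' n - riesz_approx a r n)) \<longlonglongrightarrow> norm (riesz a r' - riesz a r)"
        by (intro tendsto_intros riesz_approx_tendsto a r r')
      ultimately have "norm (riesz a r' - riesz a r) \<le> e / 2"
        by (intro tendsto_upperbound) auto
      then show ?thesis using e by (simp add: dist_norm)
    qed
    then show "\<exists>d>0. \<forall>x'\<in>{s..t}. dist x' r < d \<longrightarrow> dist (riesz a x') (riesz a r) < e"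
      using d by blast
  qed
qed

text \<open>Replaces independence of the contour: the idempotent is 1 for a large radius, and it
  depends continuously on the radius.\<close>

lemma riesz_eq_1_of_quasinilpotent:
  fixes q :: "'a::complex_banach_algebra_1"
  assumes q: "quasinilpotent q" and s: "s > 0"
  shows "riesz q s = 1"
proof (rule ccontr)
  assume ne: "riesz q s \<noteq> 1"
  have circ: "resolvent_circle q r" if "r > 0" for r
    using q that by (auto simp: quasinilpotent_iff resolvent_circle_def)
  have idem: "norm (1 - riesz q r) \<le> norm (1 - riesz q r) * norm (1 - riesz q r)" if "r > 0" for r
  proof -
    have "(1 - riesz q r) * (1 - riesz q r) = 1 - riesz q r"
      by (simp add: algebra_simps riesz_idem[OF circ[OF that]])
    then show ?thesis by (metis norm_mult_ineq)
  qed
  \<comment> \<open>The radius \<open>t + 1\<close> exceeds both \<open>s\<close> and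
    \<open>norm q\<close>, so the idempotent is already known there.\<close>
  define t where "t = s + norm q"
  have "riesz q (t + 1) = 1"
    using s by (intro riesz_eq_1_of_norm_less circ) (auto simp: t_def add_pos_nonneg add_nonneg_pos)
  moreover have "norm (1 - riesz q s) \<ge> 1"
    using idem[OF s] ne by (simp add: mult_le_cancel_left1)
  moreover have "continuous_on {s..t + 1} (\<lambda>r. norm (1 - riesz q r))"
    using s by (intro continuous_intros continuous_on_riesz circ) auto
  \<comment> \<open>A nonzero idempotent has norm at least 1, so the norm cannot pass continuously from \<open>\<ge> 1\<close> to 0.\<close>
  ultimately obtain r where r: "s \<le> r" "norm (1 - riesz q r) = 1 / 2"
    using IVT2'[of "\<lambda>r. norm (1 - riesz q r)" "t + 1" "1 / 2" s] by (auto simp: t_def)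
  show False using idem[of r] r s by simp
qed

text \<open>A Cauchy estimate: since the Riesz idempotent is 1, \<open>q ^ N\<close> is the limit of
  averages of \<open>z^N * z * resolv q z\<close> over a circle of radius \<open>s\<close>. A pole
  of order at most \<open>N\<close> bounds these by \<open>s\<close>, and \<open>s\<close> is
  arbitrarily small.\<close>

lemma quasinilpotent_pole_imp_nilpotent:
  fixes q :: "'a::complex_banach_algebra_1"
  assumes q: "quasinilpotent q" and pole: "inv_tame True (\<lambda>z. cscal z - q)"
  shows "\<exists>n. q ^ n = 0"
proof -
  obtain Y where Y: "\<forall>\<^sub>F z in at 0. is_inv (cscal z - q) (Y z)" "tame Y"
    using inv_tameE[OF pole] by blast
  then obtain N where "\<forall>\<^sub>F z in at 0. norm (Y z) \<le> inverse (cmod z) ^ N"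
    unfolding tame_def by blast
  with Y(1) have "\<forall>\<^sub>F z in at 0. norm (resolv q z) \<le> inverse (cmod z) ^ N"
    by eventually_elim (simp add: resolv_eqI)
  then obtain d where d: "d > 0" and bd: "\<And>z. z \<noteq> 0 \<Longrightarrow> cmod z < d \<Longrightarrow> norm (resolv q z) \<le> inverse (cmod z) ^ N"
    by (auto simp: eventually_at)
  have "norm (q ^ N) \<le> s" if s: "0 < s" "s < d" for s
  proof -
    have circ: "resolvent_circle q s"
      using q s by (auto simp: quasinilpotent_iff resolvent_circle_def)
    have "norm (q ^ N * riesz_approx q s n) \<le> s" if n: "N < n" for n
      unfolding circ_avg_eq_power_mult_riesz_approx[OF circ n, symmetric]
    proof (rule circ_avg_norm_le)
      fix z assume z: "cmod z = s"
      have "norm (cscal (z ^ N) * (cscal z * resolv q z)) = s ^ N * (s * norm (resolv q z))"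
        by (simp add: norm_cscal_mult norm_power z)
      also have "\<dots> \<le> s ^ N * (s * inverse s ^ N)"
        using bd[of z] z s by (intro mult_left_mono) auto
      also have "\<dots> = s" using s by (simp add: power_inverse)
      finally show "norm (cscal (z ^ N) * (cscal z * resolv q z)) \<le> s" .
    qed (use n s in auto)
    then have "\<forall>\<^sub>F n in sequentially. norm (q ^ N * riesz_approx q s n) \<le> s"
      using eventually_gt_at_top[of N] by (rule eventually_mono[rotated])
    moreover have "(\<lambda>n. norm (q ^ N * riesz_approx q s n)) \<longlonglongrightarrow> norm (q ^ N * riesz q s)"
      by (intro tendsto_intros riesz_approx_tendsto circ)
    ultimately have "norm (q ^ N * riesz q s) \<le> s"
      by (intro tendsto_upperbound) auto
    then show ?thesis using riesz_eq_1_of_quasinilpotent[OF q s(1)] by simp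
  qed
  then have "norm (q ^ N) \<le> 0"
    using d field_le_epsilon[of "norm (q ^ N)" 0]
    by (metis add_0 dense_ge_bounded)
  then show ?thesis by auto
qed

section \<open>Characterization of both notions by the resolvent near the origin\<close>

lemma gdrazin_invertible_iff: "gdrazin_invertible a \<longleftrightarrow> inv_tame False (\<lambda>z. cscal z - a)"
proof
  assume "inv_tame False (\<lambda>z. cscal z - a)"
  then obtain Y where "\<forall>\<^sub>F z in at 0. is_inv (cscal z - a) (Y z)" by (rule inv_tameE)
  then obtain d where d: "d > 0" "\<And>z. z \<noteq> 0 \<Longrightarrow> cmod z < d \<Longrightarrow> is_inv (cscal z - a) (Y z)"
    by (auto simp: eventually_at)
  show "gdrazin_invertible a"
    unfolding gdrazin_invertible_def
  \<comment> \<open>Half the radius, because a closed punctured disc is required while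
    \<open>d\<close> describes an open one.\<close>
  proof (rule ex_gdrazin_inverse[of "d / 2"])
    fix z assume "0 < cmod z" "cmod z \<le> d / 2"
    then show "alg_invertible (cscal z - a)"
      using d(2)[of z] d(1) by (auto simp: alg_invertible_iff)
  qed (use d in simp)
qed (rule gdrazin_imp_inv_tame)

text \<open>The g-Drazin inverse already exists. Its quasinilpotent part inherits a pole from the
  resolvent of \<open>a\<close> through the explicit spectral formula, and is therefore
  nilpotent.\<close>

lemma drazin_invertible_iff: "drazin_invertible a \<longleftrightarrow> inv_tame True (\<lambda>z. cscal z - a)"
proof
  assume a: "inv_tame True (\<lambda>z. cscal z - a)"
  then have "inv_tame False (\<lambda>z. cscal z - a)" unfolding inv_tame_def by blast
  then obtain b where b: "a * b = b * a" "b * a * b = b" and q: "quasinilpotent (a * (1 - a * b))"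
    unfolding gdrazin_invertible_iff[symmetric] gdrazin_invertible_def by blast
  obtain R where R: "\<forall>\<^sub>F z in at 0. is_inv (cscal z - a) (R z)" "tame R"
    using inv_tameE[OF a] by blast
  have "inv_tame True (\<lambda>z. cscal z - a * (1 - a * b))"
  proof (rule inv_tameI)
    show "\<forall>\<^sub>F z in at 0. is_inv (cscal z - a * (1 - a * b)) (R z * (1 - a * b) + cscal (inverse z ^ 1) * (a * b))"
      using R(1) eventually_neq_0 by eventually_elim (simp add: is_inv_spectral_part[OF b])
    show "tame (\<lambda>z. R z * (1 - a * b) + cscal (inverse z ^ 1) * (a * b))"
      by (intro tame_add tame_mult tame_const R tame_cscal_inverse_power)
  qed
  then show "drazin_invertible a"
    unfolding drazin_invertible_def using b quasinilpotent_pole_imp_nilpotent[OF q] by blast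
qed (rule drazin_imp_inv_tame)

subsection \<open>The resolvents of the four elements\<close>

text \<open>The lower bound on \<open>L\<close> turns a pole in \<open>L z\<close> into a pole in
  \<open>z\<close>.\<close>

lemma inv_tame_compose:
  assumes X: "inv_tame pole X" and L: "filterlim L (at 0) (at 0)"
    and lower: "\<forall>\<^sub>F z in at 0. cmod z ^ k \<le> cmod (L z)"
  shows "inv_tame pole (\<lambda>z. X (L z))"
proof -
  obtain Y where Y: "\<forall>\<^sub>F z in at 0. is_inv (X z) (Y z)" "pole \<Longrightarrow> tame Y"
    using inv_tameE[OF X] by blast
  show ?thesis
  proof (rule inv_tameI)
    show "\<forall>\<^sub>F z in at 0. is_inv (X (L z)) (Y (L z))"
      by (rule eventually_compose_filterlim[OF Y(1) L])
    assume pole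
    then obtain N where "\<forall>\<^sub>F z in at 0. norm (Y z) \<le> inverse (cmod z) ^ N"
      using Y(2) unfolding tame_def by blast
    from eventually_compose_filterlim[OF this L]
    have "\<forall>\<^sub>F z in at 0. norm (Y (L z)) \<le> inverse (cmod z) ^ (k * N)"
      using lower eventually_neq_0
    proof eventually_elim
      case (elim z)
      have "inverse (cmod (L z)) ^ N \<le> (inverse (cmod z) ^ k) ^ N"
        unfolding power_inverse[of _ k] using elim by (intro power_mono le_imp_inverse_le) auto
      with elim show ?case by (simp add: power_mult)
    qed
    then show "tame (\<lambda>z. Y (L z))" unfolding tame_def by blast
  qed
qed

text \<open>Converse substitution. The filter inequality says that \<open>L\<close> maps punctured
  neighbourhoods of 0 onto sets containing punctured neighbourhoods of 0; the upper bound on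
  \<open>L\<close> rewrites a pole in \<open>z\<close> as one in \<open>L z\<close>.\<close>

lemma inv_tame_of_compose:
  assumes XL: "inv_tame pole (\<lambda>z. cscal (L z) - a)" and L: "at 0 \<le> filtermap L (at 0)"
    and upper: "\<forall>\<^sub>F z in at 0. cmod (L z) ^ k \<le> cmod z"
    and L0: "\<forall>\<^sub>F z in at 0. L z \<noteq> 0"
  shows "inv_tame pole (\<lambda>z. cscal z - a)"
proof -
  have transfer: "\<forall>\<^sub>F z in at 0. Q z" if "\<forall>\<^sub>F z in at 0. Q (L z)" for Q
    using filter_leD[OF L] that by (simp add: eventually_filtermap)
  obtain Y where Y: "\<forall>\<^sub>F z in at 0. is_inv (cscal (L z) - a) (Y z)" "pole \<Longrightarrow> tame Y"
    using inv_tameE[OF XL] by blast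
  show ?thesis
  \<comment> \<open>\<open>Y\<close> is indexed by preimages under \<open>L\<close>, which need not
    be unique; \<open>resolv a\<close> depends only on the image point and agrees with
    \<open>Y\<close> there.\<close>
  proof (rule inv_tameI)
    show "\<forall>\<^sub>F z in at 0. is_inv (cscal z - a) (resolv a z)"
      by (rule transfer) (use Y(1) in \<open>eventually_elim, simp add: resolv_eqI\<close>)
    assume pole
    then obtain N where "\<forall>\<^sub>F z in at 0. norm (Y z) \<le> inverse (cmod z) ^ N"
      using Y(2) unfolding tame_def by blast
    then have "\<forall>\<^sub>F z in at 0. norm (resolv a (L z)) \<le> inverse (cmod (L z)) ^ (k * N)"
      using Y(1) upper L0
    proof eventually_elim
      case (elim z)
      have "inverse (cmod z) ^ N \<le> (inverse (cmod (L z)) ^ k) ^ N"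
        unfolding power_inverse[of _ k] using elim by (intro power_mono le_imp_inverse_le) auto
      with elim show ?case by (simp add: power_mult resolv_eqI)
    qed
    then have "\<forall>\<^sub>F w in at 0. norm (resolv a w) \<le> inverse (cmod w) ^ (k * N)"
      by (rule transfer)
    then show "tame (resolv a)" unfolding tame_def by blast
  qed
qed

text \<open>The exponents are one above the worst vanishing order, to absorb constants:
  \<open>z - \<alpha>2 * z\<^sup>2 - \<beta>\<close> vanishes to order at most 1, and
  \<open>L\<close> to order at least 1 and at most 3 (when \<alpha>1 = 0 and \<beta> is
  nonzero).\<close>

lemma ex_spectral_parameter:
  fixes \<alpha>1 \<alpha>2 \<beta> :: complex
  obtains L where
    "\<forall>\<^sub>F z in at 0. (z - \<alpha>2 * z\<^sup>2 - \<beta>) * L z = z\<^sup>2 * (\<alpha>1 - z)"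
    "\<forall>\<^sub>F z in at 0. cmod z ^ 2 \<le> cmod (z - \<alpha>2 * z\<^sup>2 - \<beta>)"
    "filterlim L (at 0) (at 0)" "at 0 \<le> filtermap L (at 0)"
    "\<forall>\<^sub>F z in at 0. cmod z ^ 4 \<le> cmod (L z)" "\<forall>\<^sub>F z in at 0. cmod (L z) ^ 2 \<le> cmod z"
proof
  \<comment> \<open>For \<open>\<beta> = 0\<close> the removable singularity of \<open>L\<close> at 0 is cancelled by hand.\<close>
  define m where "m z = (if \<beta> = 0 then z else 1)" for z :: complex
  define A where "A z = (if \<beta> = 0 then 1 else z) * (\<alpha>1 - z)" for z
  define D where "D z = (if \<beta> = 0 then 1 - \<alpha>2 * z else z - \<alpha>2 * z\<^sup>2 - \<beta>)" for z
  define L where "L z = z * A z / D z" for z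
  have q: "z - \<alpha>2 * z\<^sup>2 - \<beta> = m z * D z" and mA: "m z * A z = z * (\<alpha>1 - z)" for z
    by (simp_all add: m_def D_def A_def algebra_simps power2_eq_square)
  have D0: "D 0 \<noteq> 0" by (simp add: D_def)
  have "isCont D 0"
    unfolding D_def by (cases "\<beta> = 0"; simp)
  then have D: "(D \<longlongrightarrow> D 0) (at 0)" by (rule isContD)
  have "isCont A 0"
    unfolding A_def by (cases "\<beta> = 0"; simp)
  then have A: "(A \<longlongrightarrow> A 0) (at 0)" by (rule isContD)
  have evD: "\<forall>\<^sub>F z in at 0. D z \<noteq> 0" by (rule tendsto_imp_eventually_ne[OF D D0])
  have small: "\<forall>\<^sub>F z::complex in at 0. cmod z < 1" by (rule eventually_norm_less_at_0) simp
  \<comment> \<open>Values below 1 of these three null functions are exactly the estimates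
    \<open>|z| < |D z|\<close>, \<open>|z * D z| < 1\<close> and, after multiplication by
    \<open>|z|\<close>, \<open>|L z|^2 \<le> |z|\<close>.\<close>
  have "((\<lambda>z. norm (z / D z)) \<longlongrightarrow> norm (0 / D 0)) (at 0)" "((\<lambda>z. norm (z * D z)) \<longlongrightarrow> norm (0 * D 0)) (at 0)"
    "((\<lambda>z. norm (z * (A z / D z)\<^sup>2)) \<longlongrightarrow> norm (0 * (A 0 / D 0)\<^sup>2)) (at 0)"
    by (intro tendsto_intros D A D0)+
  then have lims: "((\<lambda>z. norm (z / D z)) \<longlongrightarrow> 0) (at 0)" "((\<lambda>z. norm (z * D z)) \<longlongrightarrow> 0) (at 0)"
    "((\<lambda>z. norm (z * (A z / D z)\<^sup>2)) \<longlongrightarrow> 0) (at 0)"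
    by simp_all
  have ev1: "\<forall>\<^sub>F z in at 0. norm (z / D z) < 1" "\<forall>\<^sub>F z in at 0. norm (z * D z) < 1"
    "\<forall>\<^sub>F z in at 0. norm (z * (A z / D z)\<^sup>2) < 1"
    by (rule order_tendstoD(2)[OF lims(1)] order_tendstoD(2)[OF lims(2)] order_tendstoD(2)[OF lims(3)], simp)+
  have \<alpha>: "\<forall>\<^sub>F z in at 0. cmod z \<le> cmod (\<alpha>1 - z)"
  proof (cases "\<alpha>1 = 0")
    case False
    then have "\<forall>\<^sub>F z::complex in at 0. cmod z < cmod \<alpha>1 / 2"
      by (intro eventually_norm_less_at_0) simp
    then show ?thesis
      by eventually_elim (use norm_triangle_ineq2 in \<open>smt (verit) field_sum_of_halves\<close>)
  qed simp
  show "\<forall>\<^sub>F z in at 0. (z - \<alpha>2 * z\<^sup>2 - \<beta>) * L z = z\<^sup>2 * (\<alpha>1 - z)"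
    using evD
  proof eventually_elim
    case (elim z)
    then have "m z * D z * L z = z * (m z * A z)" by (simp add: L_def)
    then show ?case unfolding q mA by (simp add: power2_eq_square mult.assoc)
  qed
  show "\<forall>\<^sub>F z in at 0. cmod z ^ 2 \<le> cmod (z - \<alpha>2 * z\<^sup>2 - \<beta>)"
    using evD ev1(1) small
  proof eventually_elim
    case (elim z)
    have "cmod z \<le> cmod (D z)" using elim by (simp add: norm_divide)
    moreover have "cmod z \<le> cmod (m z)" using elim by (simp add: m_def)
    ultimately show ?case unfolding q norm_mult power2_eq_square[of "cmod z"] by (intro mult_mono) auto
  qed
  show lower: "\<forall>\<^sub>F z in at 0. cmod z ^ 4 \<le> cmod (L z)"
    using evD ev1(2) small \<alpha>
  proof eventually_elim
    case (elim z)
    have "cmod z * cmod (D z) \<le> 1" using elim by (simp add: norm_mult)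
    moreover have "cmod z * cmod z \<le> cmod (A z)"
      unfolding A_def norm_mult using elim by (intro mult_mono) auto
    ultimately have "(cmod z * cmod (D z)) * (cmod z * (cmod z * cmod z)) \<le> 1 * (cmod z * cmod (A z))"
      by (intro mult_mono) auto
    then show ?case
      using elim by (simp add: L_def norm_mult norm_divide field_simps power4_eq_xxxx)
  qed
  show "\<forall>\<^sub>F z in at 0. cmod (L z) ^ 2 \<le> cmod z"
    using ev1(3)
  proof eventually_elim
    case (elim z)
    have "cmod (L z) ^ 2 = cmod z * cmod (z * (A z / D z)\<^sup>2)"
      by (simp add: L_def norm_mult norm_divide norm_power power2_eq_square)
    also have "\<dots> \<le> cmod z * 1" using elim by (intro mult_left_mono) auto
    finally show ?case by simp
  qed
  have L0: "L 0 = 0" by (simp add: L_def)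
  have "(L \<longlongrightarrow> 0 * A 0 / D 0) (at 0)"
    unfolding L_def by (intro tendsto_intros D A D0)
  then have Llim: "(L \<longlongrightarrow> 0) (at 0)" by simp
  have ne: "\<forall>\<^sub>F z in at 0. L z \<noteq> 0"
    using lower eventually_neq_0 by eventually_elim auto
  show "filterlim L (at 0) (at 0)"
    using Llim ne by (simp add: filterlim_at)
  obtain d0 where d0: "d0 > 0" "\<And>z. z \<noteq> 0 \<Longrightarrow> cmod z < d0 \<Longrightarrow> D z \<noteq> 0 \<and> L z \<noteq> 0"
    using eventually_conj[OF evD ne] by (auto simp: eventually_at)
  show "at 0 \<le> filtermap L (at 0)"
  proof (rule filter_leI)
    fix Q assume "\<forall>\<^sub>F z in filtermap L (at 0). Q z"
    then have "\<forall>\<^sub>F z in at 0. Q (L z)" by (simp add: eventually_filtermap)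
    then obtain d1 where d1: "d1 > 0" "\<And>z. z \<noteq> 0 \<Longrightarrow> cmod z < d1 \<Longrightarrow> Q (L z)"
      by (auto simp: eventually_at)
    define d where "d = min d0 d1"
    have d: "d > 0" using d0 d1 by (simp add: d_def)
    \<comment> \<open>The centre is included: \<open>D 0 \<noteq> 0\<close> makes the quotient
      holomorphic on the whole ball, as the open mapping theorem requires.\<close>
    have "D z \<noteq> 0" if "z \<in> ball 0 d" for z
      using that d0(2)[of z] D0 by (cases "z = 0") (auto simp: d_def)
    then have "L holomorphic_on ball 0 d"
      unfolding L_def A_def D_def by (cases "\<beta> = 0") (auto intro!: holomorphic_intros)
    moreover have "\<not> L constant_on ball 0 d"
    proof
      assume "L constant_on ball 0 d"
      moreover have "of_real (d / 2) \<in> ball (0::complex) d" "0 \<in> ball (0::complex) d" using d by auto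
      ultimately have "L (of_real (d / 2)) = 0" using L0 unfolding constant_on_def by metis
      moreover have "d \<le> d0" by (simp add: d_def)
      ultimately show False using d0(2)[of "of_real (d / 2)"] d by auto
    qed
    ultimately have "open (L ` ball 0 d)"
      by (intro open_mapping_thm[of L "ball 0 d"]) auto
    moreover have "0 \<in> L ` ball 0 d" using d L0 by (intro image_eqI[of _ _ 0]) auto
    ultimately have "\<forall>\<^sub>F w in at 0. w \<in> L ` ball 0 d"
      by (intro eventually_at_in_open') auto
    then show "\<forall>\<^sub>F w in at 0. Q w"
      using eventually_neq_0
    proof eventually_elim
      case (elim w)
      then obtain z where z: "cmod z < d" "w = L z" by auto
      then have "z \<noteq> 0" using elim L0 by auto
      then show ?case using d1(2)[of z] z by (simp add: d_def)
    qed
  qed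
qed

text \<open>Scalars are central and the expansion keeps the order of the factors, so only products
  with increasing indices occur: exactly those in the hypotheses, although the \<open>x\<close>'s
  need not commute. The number \<open>w\<close> stands for \<open>L z\<close>.\<close>

lemma resolvent_product:
  fixes x1 x2 x3 :: "'a::complex_banach_algebra_1" and \<alpha>1 \<alpha>2 \<beta> z w :: complex
  defines "u \<equiv> x1 * x2 + x1 * x3 + x2 * x3"
  assumes h1: "x1 + x2 + x3 = cscal \<alpha>1 + cscal \<alpha>2 * u"
    and h2: "x1 * x2 * x3 = cscal \<beta> * u"
    and w: "(z - \<alpha>2 * z\<^sup>2 - \<beta>) * w = z\<^sup>2 * (\<alpha>1 - z)"
  shows "(cscal z - x1) * ((cscal z - x2) * (cscal z - x3)) = cscal (- (z - \<alpha>2 * z\<^sup>2 - \<beta>)) * (cscal w - u)"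
proof -
  let ?Z = "cscal z :: 'a"
  have "(?Z - x1) * ((?Z - x2) * (?Z - x3)) =
      ?Z * ?Z * ?Z - ?Z * ?Z * (x1 + x2 + x3) + ?Z * u - x1 * x2 * x3"
    by (simp add: u_def algebra_simps cscal_commute[of x1] cscal_commute[of x2] cscal_commute[of x3]
        cscal_left_commute[of x1] cscal_left_commute[of x2] cscal_left_commute[of x3])
  also have "\<dots> = cscal (z * z * z - z * z * \<alpha>1) + cscal (z - \<alpha>2 * z\<^sup>2 - \<beta>) * u"
  proof -
    have "z - \<alpha>2 * z\<^sup>2 - \<beta> = z - z * z * \<alpha>2 - \<beta>" by (simp add: power2_eq_square)
    then have "cscal (z - \<alpha>2 * z\<^sup>2 - \<beta>) * u = ?Z * u - cscal (z * z * \<alpha>2) * u - cscal \<beta> * u"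
      by (simp only: cscal_diff left_diff_distrib)
    then show ?thesis
      unfolding h1 h2 by (simp add: cscal_mult cscal_diff distrib_left mult.assoc)
  qed
  also have "z * z * z - z * z * \<alpha>1 = - (z - \<alpha>2 * z\<^sup>2 - \<beta>) * w"
    using w by (simp add: algebra_simps power2_eq_square)
  finally show ?thesis
    by (simp only: cscal_mult cscal_minus right_diff_distrib mult_minus_left diff_minus_eq_add)
qed

text \<open>The flag \<open>pole\<close> treats both notions of invertibility at once; every case is
  cancellation in the identity of \<open>resolvent_product\<close>.\<close>

lemma inv_tame_three_of_four:
  fixes x1 x2 x3 :: "'a::complex_banach_algebra_1" and \<alpha>1 \<alpha>2 \<beta> :: complex and pole :: bool
  defines "u \<equiv> x1 * x2 + x1 * x3 + x2 * x3"
  defines "T \<equiv> \<lambda>a. inv_tame pole (\<lambda>z. cscal z - a)"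
  assumes h1: "x1 + x2 + x3 = cscal \<alpha>1 + cscal \<alpha>2 * u"
    and h2: "x1 * x2 * x3 = cscal \<beta> * u"
  shows "T x2 \<Longrightarrow> T x3 \<Longrightarrow> T u \<Longrightarrow> T x1" "T x1 \<Longrightarrow> T x3 \<Longrightarrow> T u \<Longrightarrow> T x2"
    "T x1 \<Longrightarrow> T x2 \<Longrightarrow> T u \<Longrightarrow> T x3" "T x1 \<Longrightarrow> T x2 \<Longrightarrow> T x3 \<Longrightarrow> T u"
proof -
  let ?q = "\<lambda>z. z - \<alpha>2 * z\<^sup>2 - \<beta>"
  obtain L where L:
    "\<forall>\<^sub>F z in at 0. ?q z * L z = z\<^sup>2 * (\<alpha>1 - z)"
    "\<forall>\<^sub>F z in at 0. cmod z ^ 2 \<le> cmod (?q z)"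
    "filterlim L (at 0) (at 0)" "at 0 \<le> filtermap L (at 0)"
    "\<forall>\<^sub>F z in at 0. cmod z ^ 4 \<le> cmod (L z)" "\<forall>\<^sub>F z in at 0. cmod (L z) ^ 2 \<le> cmod z"
    by (rule ex_spectral_parameter)
  let ?X = "\<lambda>x z. cscal z - x :: 'a" and ?S = "\<lambda>z. cscal (- ?q z) :: 'a"
  have eq: "\<forall>\<^sub>F z in at 0. ?X x1 z * (?X x2 z * ?X x3 z) = ?S z * (cscal (L z) - u)"
    using L(1) unfolding u_def
    by eventually_elim (rule resolvent_product[OF h1[unfolded u_def] h2[unfolded u_def]])
  then have eq': "\<forall>\<^sub>F z in at 0. ?S z * (cscal (L z) - u) = ?X x1 z * (?X x2 z * ?X x3 z)"
    by eventually_elim simp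
  have tX: "tame (?X x)" for x by (rule tame_cscal_diff) simp
  have tS: "tame ?S"
    using tame_cscal_diff[of "\<lambda>z. - ?q z" "0::'a"] by simp
  have S: "inv_tame pole ?S"
  proof (rule inv_tameI)
    have "\<forall>\<^sub>F z in at 0. ?q z \<noteq> 0"
      using L(2) eventually_neq_0 by eventually_elim auto
    then show "\<forall>\<^sub>F z in at 0. is_inv (?S z) (cscal (inverse (- ?q z)))"
      by eventually_elim (intro is_inv_cscal, simp)
    have "\<forall>\<^sub>F z in at 0. norm (cscal (inverse (- ?q z)) :: 'a) \<le> inverse (cmod z) ^ 2"
      using L(2) eventually_neq_0
    proof eventually_elim
      case (elim z)
      then show ?case
        unfolding norm_cscal norm_inverse norm_minus_cancel power_inverse
        by (intro le_imp_inverse_le) auto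
    qed
    then show "tame (\<lambda>z. cscal (inverse (- ?q z)) :: 'a)" unfolding tame_def by blast
  qed
  have uL: "inv_tame pole (\<lambda>z. ?X x1 z * (?X x2 z * ?X x3 z))" if "T u"
  proof (rule inv_tame_cong[OF inv_tame_mult[OF S] eq'])
    show "inv_tame pole (\<lambda>z. cscal (L z) - u)"
      using that unfolding T_def by (rule inv_tame_compose[OF _ L(3,5)])
  qed
  show "T x1" if "T x2" "T x3" "T u"
    using inv_tame_cancel_right[OF uL] that inv_tame_mult tame_mult tX unfolding T_def by blast
  \<comment> \<open>Cancellation is possible only at the ends of the product, so the middle factor
    is reached by removing \<open>x1\<close> on the left and then \<open>x3\<close> on the
    right.\<close>
  show "T x2" if "T x1" "T x3" "T u"
    using inv_tame_cancel_right[OF inv_tame_cancel_left[OF uL]] that tX unfolding T_def by blast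
  show "T x3" if "T x1" "T x2" "T u"
    using inv_tame_cancel_left[OF inv_tame_cancel_left[OF uL]] that tX unfolding T_def by blast
  show "T u" if "T x1" "T x2" "T x3"
  proof -
    have "inv_tame pole (\<lambda>z. ?X x1 z * (?X x2 z * ?X x3 z))"
      using that unfolding T_def by (intro inv_tame_mult)
    then have "inv_tame pole (\<lambda>z. cscal (L z) - u)"
      using inv_tame_cancel_left[OF inv_tame_cong[OF _ eq] S tS] by blast
    moreover have "\<forall>\<^sub>F z in at 0. L z \<noteq> 0"
      using L(5) eventually_neq_0 by eventually_elim auto
    ultimately show ?thesis
      unfolding T_def using inv_tame_of_compose L(4,6) by blast
  qed
qed

theorem theorem2p3:
  fixes x1 x2 x3 :: "'a::complex_banach_algebra_1"
    and \<alpha>1 \<alpha>2 \<beta> :: complex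
  assumes h1: "x1 + x2 + x3 = cscal \<alpha>1 + cscal \<alpha>2 * (x1 * x2 + x1 * x3 + x2 * x3)"
    and h2: "x1 * x2 * x3 = cscal \<beta> * (x1 * x2 + x1 * x3 + x2 * x3)"
  defines "X \<equiv> [x1, x2, x3, x1 * x2 + x1 * x3 + x2 * x3]"
  shows "(\<forall>i<4. (\<forall>j<4. j \<noteq> i \<longrightarrow> drazin_invertible (X ! j)) \<longrightarrow> drazin_invertible (X ! i)) \<and>
         (\<forall>i<4. (\<forall>j<4. j \<noteq> i \<longrightarrow> gdrazin_invertible (X ! j)) \<longrightarrow> gdrazin_invertible (X ! i))"
proof -
  have all4: "(\<forall>i<4. Q i) \<longleftrightarrow> Q 0 \<and> Q 1 \<and> Q 2 \<and> Q 3" for Q :: "nat \<Rightarrow> bool"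
    by (simp add: eval_nat_numeral All_less_Suc conj_ac)
  have X: "X ! 0 = x1" "X ! 1 = x2" "X ! 2 = x3" "X ! 3 = x1 * x2 + x1 * x3 + x2 * x3"
    by (simp_all add: X_def eval_nat_numeral)
  show ?thesis
    unfolding all4 X drazin_invertible_iff gdrazin_invertible_iff
    using inv_tame_three_of_four[OF h1 h2] by simp
qed

end
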